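(* Suppose that $R$ is an $F$-finite reduced ring of characteristic $p > 0$ and that $R \subseteq R^{\mathrm{N}}$ is its normalization, with conductor $\mathfrak{c}$. If $R^{\mathrm{N}}$ is strongly $F$-regular, then $$\mathfrak{c} = \tau_{\mathrm{fg}}(R) = \tau_b(R).$$
   Context: Rings are commutative Noetherian of prime characteristic $p>0$. A ring is $F$-finite if its Frobenius endomorphism is a finite map. $R^{\mathrm N}$ is the integral closure of $R$ in its total ring of fractions, and the conductor is $\mathfrak c=\operatorname{Ann}_R(R^{\mathrm N}/R)$. $R^\circ$ is the set of elements in no minimal prime of $R$. ${}^eR=\{{}^ex:x\in R\}$ is $R$ viewed as an $R$-module via $r\cdot{}^ex={}^e(r^{p^e}x)$. An $F$-finite ring $R$ is strongly $F$-regular if for every $c\in R^\circ$ there are $e\ge0$ and an $R$-linear map ${}^eR\to R$ sending ${}^ec\mapsto1$. For an ideal $I$, the tight closure $I^*$ is the set of $x\in R$ for which there is $c\in R^\circ$ with $cx^{p^e}\in I^{[p^e]}$ for all $e\gg0$, where $I^{[p^e]}$ is generated by the $p^e$-th powers of elements of $I$. For an $R$-module $M$, $0^*_M$ is the set of $z\in M$ for which there is $c\in R^\circ$ with ${}^ec\otimes z=0$ in ${}^eR\otimes_RM$ for all $e\gg0$. The finitistic test ideal is $\tau_{\mathrm{fg}}(R)=\bigcap_{I\subseteq R}(I:I^* )$ over all ideals $I$, and the big test ideal is $\tau_b(R)=\bigcap_M\operatorname{Ann}_R(0^*_M)$ over all $R$-modules $M$. *)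

theory Defs
  imports "HOL-Algebra.Algebra" "HOL-Computational_Algebra.Primes"
begin

section \<open>Rings\<close>

definition has_characteristic :: "('a, 'r) ring_scheme \<Rightarrow> nat \<Rightarrow> bool" where
  "has_characteristic R p \<longleftrightarrow> (\<forall>n::nat. [n] \<cdot>\<^bsub>R\<^esub> \<one>\<^bsub>R\<^esub> = \<zero>\<^bsub>R\<^esub> \<longleftrightarrow> p dvd n)"

definition reduced_ring :: "('a, 'r) ring_scheme \<Rightarrow> bool" where
  "reduced_ring R \<longleftrightarrow>
     (\<forall>x\<in>carrier R. \<forall>n::nat. x [^]\<^bsub>R\<^esub> n = \<zero>\<^bsub>R\<^esub> \<longrightarrow> x = \<zero>\<^bsub>R\<^esub>)"

definition minimal_prime :: "'a set \<Rightarrow> ('a, 'r) ring_scheme \<Rightarrow> bool" where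
  "minimal_prime P R \<longleftrightarrow> primeideal P R \<and> (\<forall>Q. primeideal Q R \<and> Q \<subseteq> P \<longrightarrow> Q = P)"

text \<open>The set usually written \<open>R\<close> with a superscript circle.\<close>

definition off_minimal_primes :: "('a, 'r) ring_scheme \<Rightarrow> 'a set" where
  "off_minimal_primes R = {c \<in> carrier R. \<forall>P. minimal_prime P R \<longrightarrow> c \<notin> P}"

definition nonzerodivisors :: "('a, 'r) ring_scheme \<Rightarrow> 'a set" where
  "nonzerodivisors R =
     {s \<in> carrier R. \<forall>x\<in>carrier R. s \<otimes>\<^bsub>R\<^esub> x = \<zero>\<^bsub>R\<^esub> \<longrightarrow> x = \<zero>\<^bsub>R\<^esub>}"

definition ideal_colon :: "('a, 'r) ring_scheme \<Rightarrow> 'a set \<Rightarrow> 'a set \<Rightarrow> 'a set" where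
  "ideal_colon R I J = {r \<in> carrier R. \<forall>x\<in>J. r \<otimes>\<^bsub>R\<^esub> x \<in> I}"


section \<open>Total ring of fractions, normalization and conductor\<close>

text \<open>The total ring of fractions is the localization of \<open>R\<close> at its nonzerodivisors, which is
  determined up to unique isomorphism over \<open>R\<close>. The predicate says that \<open>K\<close>, together with the
  structure map \<open>\<iota>\<close>, is such a localization; \<open>\<iota>\<close> plays the role of the inclusion of \<open>R\<close>.\<close>

definition total_ring_of_fractions ::
  "('a, 'r) ring_scheme \<Rightarrow> ('k, 's) ring_scheme \<Rightarrow> ('a \<Rightarrow> 'k) \<Rightarrow> bool" where
  "total_ring_of_fractions R K \<iota> \<longleftrightarrow>
     cring K \<and> \<iota> \<in> ring_hom R K \<and> inj_on \<iota> (carrier R) \<and>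
     (\<forall>s\<in>nonzerodivisors R. \<iota> s \<in> Units K) \<and>
     (\<forall>y\<in>carrier K. \<exists>a\<in>carrier R. \<exists>s\<in>nonzerodivisors R. y = \<iota> a \<otimes>\<^bsub>K\<^esub> inv\<^bsub>K\<^esub> (\<iota> s))"

definition integral_over ::
  "('a, 'r) ring_scheme \<Rightarrow> ('k, 's) ring_scheme \<Rightarrow> ('a \<Rightarrow> 'k) \<Rightarrow> 'k \<Rightarrow> bool" where
  "integral_over R K \<iota> y \<longleftrightarrow>
     (\<exists>n::nat. \<exists>a. a \<in> {..<n} \<rightarrow> carrier R \<and>
        y [^]\<^bsub>K\<^esub> n \<oplus>\<^bsub>K\<^esub> (\<Oplus>\<^bsub>K\<^esub>i\<in>{..<n}. \<iota> (a i) \<otimes>\<^bsub>K\<^esub> y [^]\<^bsub>K\<^esub> i) = \<zero>\<^bsub>K\<^esub>)"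

text \<open>For \<open>K\<close> the total ring of fractions of \<open>R\<close>, this is the ring \<open>R\<^sup>N\<close>, as a subring of \<open>K\<close>.\<close>

definition normalization ::
  "('a, 'r) ring_scheme \<Rightarrow> ('k, 's) ring_scheme \<Rightarrow> ('a \<Rightarrow> 'k) \<Rightarrow> ('k, 's) ring_scheme" where
  "normalization R K \<iota> = K\<lparr>carrier := {y \<in> carrier K. integral_over R K \<iota> y}\<rparr>"

text \<open>The annihilator of \<open>R\<^sup>N/R\<close>: the class of \<open>y\<close> in the quotient is killed by \<open>r\<close> iff
  \<open>r y\<close> lies in the image of \<open>R\<close>.\<close>

definition conductor ::
  "('a, 'r) ring_scheme \<Rightarrow> ('k, 's) ring_scheme \<Rightarrow> ('a \<Rightarrow> 'k) \<Rightarrow> 'a set" where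
  "conductor R K \<iota> =
     {r \<in> carrier R. \<forall>y\<in>carrier (normalization R K \<iota>). \<iota> r \<otimes>\<^bsub>K\<^esub> y \<in> \<iota> ` carrier R}"


section \<open>Modules\<close>

definition regular_module :: "('a, 'r) ring_scheme \<Rightarrow> ('a, 'a) module" where
  "regular_module R =
     \<lparr>carrier = carrier R, monoid.mult = monoid.mult R, one = monoid.one R,
      ring.zero = ring.zero R, add = add R,
      smult = monoid.mult R\<rparr>"

text \<open>The module \<open>\<^sup>eR\<close>; its element written \<open>\<^sup>ex\<close> is represented by \<open>x\<close> itself.\<close>

definition frobenius_module :: "nat \<Rightarrow> nat \<Rightarrow> ('a, 'r) ring_scheme \<Rightarrow> ('a, 'a) module" where
  "frobenius_module p e R =
     \<lparr>carrier = carrier R, monoid.mult = monoid.mult R, one = monoid.one R,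
      ring.zero = ring.zero R, add = add R,
      smult = (\<lambda>r x. (r [^]\<^bsub>R\<^esub> (p ^ e)) \<otimes>\<^bsub>R\<^esub> x)\<rparr>"

definition linear_maps ::
  "('a, 'r) ring_scheme \<Rightarrow> ('a, 'm) module \<Rightarrow> ('a, 'n) module \<Rightarrow> ('m \<Rightarrow> 'n) set" where
  "linear_maps R M N =
     {h \<in> carrier M \<rightarrow> carrier N.
        (\<forall>x\<in>carrier M. \<forall>y\<in>carrier M. h (x \<oplus>\<^bsub>M\<^esub> y) = h x \<oplus>\<^bsub>N\<^esub> h y) \<and>
        (\<forall>r\<in>carrier R. \<forall>x\<in>carrier M. h (r \<odot>\<^bsub>M\<^esub> x) = r \<odot>\<^bsub>N\<^esub> h x)}"

definition finitely_generated_module :: "('a, 'r) ring_scheme \<Rightarrow> ('a, 'm) module \<Rightarrow> bool" where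
  "finitely_generated_module R M \<longleftrightarrow>
     (\<exists>A. finite A \<and> A \<subseteq> carrier M \<and> (\<forall>H. submodule H R M \<and> A \<subseteq> H \<longrightarrow> H = carrier M))"

text \<open>The tensor product \<open>N \<otimes>\<^sub>R M\<close>, as an abelian group (written multiplicatively): the free
  abelian group on pairs modulo bilinearity and balancedness relations.\<close>

definition tensor_relations ::
  "('a, 'r) ring_scheme \<Rightarrow> ('a, 'n) module \<Rightarrow> ('a, 'm) module \<Rightarrow> ('n \<times> 'm \<Rightarrow>\<^sub>0 int) set" where
  "tensor_relations R N M =
     {frag_of (x \<oplus>\<^bsub>N\<^esub> y, z) - frag_of (x, z) - frag_of (y, z) | x y z.
        x \<in> carrier N \<and> y \<in> carrier N \<and> z \<in> carrier M} \<union>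
     {frag_of (x, z \<oplus>\<^bsub>M\<^esub> w) - frag_of (x, z) - frag_of (x, w) | x z w.
        x \<in> carrier N \<and> z \<in> carrier M \<and> w \<in> carrier M} \<union>
     {frag_of (r \<odot>\<^bsub>N\<^esub> x, z) - frag_of (x, r \<odot>\<^bsub>M\<^esub> z) | r x z.
        r \<in> carrier R \<and> x \<in> carrier N \<and> z \<in> carrier M}"

definition tensor_product ::
  "('a, 'r) ring_scheme \<Rightarrow> ('a, 'n) module \<Rightarrow> ('a, 'm) module \<Rightarrow> ('n \<times> 'm \<Rightarrow>\<^sub>0 int) set monoid"
  where
  "tensor_product R N M =
     (let F = free_Abelian_group (carrier N \<times> carrier M)
      in F Mod generate F (tensor_relations R N M))"

definition pure_tensor ::
  "('a, 'r) ring_scheme \<Rightarrow> ('a, 'n) module \<Rightarrow> ('a, 'm) module \<Rightarrow> 'n \<Rightarrow> 'm \<Rightarrow> ('n \<times> 'm \<Rightarrow>\<^sub>0 int) set"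
  where
  "pure_tensor R N M x z =
     (let F = free_Abelian_group (carrier N \<times> carrier M)
      in generate F (tensor_relations R N M) #>\<^bsub>F\<^esub> frag_of (x, z))"


section \<open>F-finiteness and strong F-regularity\<close>

text \<open>Frobenius is a finite map iff its target, a module over its source by restriction of
  scalars, is finitely generated.\<close>

definition F_finite :: "nat \<Rightarrow> ('a, 'r) ring_scheme \<Rightarrow> bool" where
  "F_finite p R \<longleftrightarrow> finitely_generated_module R (frobenius_module p 1 R)"

definition strongly_F_regular :: "nat \<Rightarrow> ('a, 'r) ring_scheme \<Rightarrow> bool" where
  "strongly_F_regular p R \<longleftrightarrow>
     F_finite p R \<and>
     (\<forall>c\<in>off_minimal_primes R. \<exists>e.
        \<exists>h\<in>linear_maps R (frobenius_module p e R) (regular_module R). h c = \<one>\<^bsub>R\<^esub>)"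


section \<open>Tight closure and test ideals\<close>

definition frobenius_power :: "('a, 'r) ring_scheme \<Rightarrow> 'a set \<Rightarrow> nat \<Rightarrow> 'a set" where
  "frobenius_power R I q = Idl\<^bsub>R\<^esub> ((\<lambda>x. x [^]\<^bsub>R\<^esub> q) ` I)"

definition tight_closure :: "nat \<Rightarrow> ('a, 'r) ring_scheme \<Rightarrow> 'a set \<Rightarrow> 'a set" where
  "tight_closure p R I =
     {x \<in> carrier R. \<exists>c\<in>off_minimal_primes R. \<forall>\<^sub>F e in sequentially.
        c \<otimes>\<^bsub>R\<^esub> x [^]\<^bsub>R\<^esub> (p ^ e) \<in> frobenius_power R I (p ^ e)}"

text \<open>The tight closure of zero in \<open>M\<close>.\<close>

definition zero_tight_closure :: "nat \<Rightarrow> ('a, 'r) ring_scheme \<Rightarrow> ('a, 'm) module \<Rightarrow> 'm set" where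
  "zero_tight_closure p R M =
     {z \<in> carrier M. \<exists>c\<in>off_minimal_primes R. \<forall>\<^sub>F e in sequentially.
        pure_tensor R (frobenius_module p e R) M c z =
          \<one>\<^bsub>tensor_product R (frobenius_module p e R) M\<^esub>}"

definition finitistic_test_ideal :: "nat \<Rightarrow> ('a, 'r) ring_scheme \<Rightarrow> 'a set" where
  "finitistic_test_ideal p R = \<Inter>{ideal_colon R I (tight_closure p R I) | I. ideal I R}"

text \<open>The intersection of the annihilators of the tight closures of zero in all \<open>R\<close>-modules with
  carrier in the type \<open>'u\<close>. This is the big test ideal as soon as \<open>'u\<close> is large enough to contain
  an isomorphic copy of every countably generated module, in particular when it contains a copy of
  the type \<open>(nat \<Rightarrow> 'a) set\<close>, in which all quotients of the free module of countable rank live.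
  Indeed \<open>z\<close> lies in the tight closure of zero in \<open>M\<close> iff it does so in some countably generated
  submodule: for each of the countably many exponents the vanishing of the tensor involves only
  finitely many elements of \<open>M\<close>.\<close>

definition big_test_ideal :: "nat \<Rightarrow> ('a, 'r) ring_scheme \<Rightarrow> 'u itself \<Rightarrow> 'a set" where
  "big_test_ideal p R (_ :: 'u itself) =
     {r \<in> carrier R. \<forall>M :: ('a, 'u) module. module R M \<longrightarrow>
        (\<forall>z\<in>zero_tight_closure p R M. r \<odot>\<^bsub>M\<^esub> z = \<zero>\<^bsub>M\<^esub>)}"

text \<open>A universe for \<open>big_test_ideal\<close> that is always large enough in the above sense and that
  also contains a copy of an arbitrary type \<open>'m\<close>; with \<open>'m\<close> left free, every \<open>R\<close>-module on any
  type is covered up to isomorphism.\<close>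

type_synonym ('a, 'm) module_universe = "(nat \<Rightarrow> 'a) set + 'm"

end

theory Submission
  imports Defs
begin

text \<open>
  The three ideals are compared in a cycle.

  The inclusion of the big test ideal in the finitistic one holds for every ring of characteristic
  \<open>p\<close>: tight closure of an ideal \<open>I\<close> is tight closure of zero in the module \<open>R/I\<close>
  (\<open>big_test_ideal_subset_finitistic_test_ideal\<close>).

  The finitistic test ideal lies in the conductor because tight closure sees integrality: if
  \<open>a/s\<close> is integral over \<open>R\<close>, its powers have a common denominator, and this puts \<open>a\<close> into the tight
  closure of \<open>sR\<close>; so a test element multiplies \<open>a/s\<close> into \<open>R\<close>
  (\<open>finitistic_test_ideal_subset_conductor\<close>).

  The conductor lies in the big test ideal because of strong \<open>F\<close>-regularity. Let \<open>r\<close> be in the conductor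
  and let \<open>c \<in> R\<^sup>\<circ>\<close> satisfy \<open>\<^sup>ec \<otimes> z = 0\<close> for \<open>e \<ge> e\<^sub>0\<close>. As \<open>R\<close> is reduced, \<open>c\<close> is a nonzerodivisor, hence
  in no minimal prime of \<open>R\<^sup>N\<close>, and for some \<open>e\<close> there is a linear map \<open>\<^sup>e(R\<^sup>N) \<rightarrow> R\<^sup>N\<close> that sends
  \<open>\<^sup>ec\<close> to \<open>1\<close>. Following it by multiplication by \<open>r\<close>, which maps \<open>R\<^sup>N\<close> into \<open>R\<close>, and restricting it to \<open>R\<close> gives a linear map
  \<open>\<^sup>eR \<rightarrow> R\<close> with \<open>\<^sup>ec \<mapsto> r\<close>; tensored with the module it shows \<open>r z = 0\<close>. The point that needs care
  is to obtain such a map with \<open>e \<ge> e\<^sub>0\<close>: this is done by iterating a Frobenius splitting, except in the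
  degenerate case that \<open>R\<close> is a product of fields, where linear algebra supplies the map
  (\<open>linear_map_to_conductor_element\<close>).
\<close>

section \<open>Minimal primes and nonzerodivisors\<close>

lemma (in cring) ideal_of_closed:
  assumes "D \<subseteq> carrier R" "\<zero> \<in> D" "\<And>x y. \<lbrakk>x \<in> D; y \<in> D\<rbrakk> \<Longrightarrow> x \<oplus> y \<in> D"
    and mult: "\<And>r x. \<lbrakk>r \<in> carrier R; x \<in> D\<rbrakk> \<Longrightarrow> r \<otimes> x \<in> D"
  shows "ideal D R"
proof (rule idealI)
  show "ring R" by (rule ring_axioms)
  show "subgroup D (add_monoid R)"
  proof
    show "inv\<^bsub>add_monoid R\<^esub> x \<in> D" if "x \<in> D" for x
    proof -
      have "x \<in> carrier R" using that assms(1) by blast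
      then have "inv\<^bsub>add_monoid R\<^esub> x = \<ominus> \<one> \<otimes> x" by (simp add: a_inv_def[symmetric] l_minus)
      then show ?thesis using mult[OF _ that, of "\<ominus> \<one>"] by simp
    qed
  qed (use assms in auto)
  show "x \<otimes> a \<in> D" if "a \<in> D" "x \<in> carrier R" for a x using mult that by blast
  show "a \<otimes> x \<in> D" if "a \<in> D" "x \<in> carrier R" for a x
  proof -
    have "a \<in> carrier R" using that assms(1) by blast
    then show ?thesis using mult[OF that(2,1)] that m_comm[of a x] by simp
  qed
qed

lemma (in cring) submonoid_adjoin:
  assumes "submonoid T R" and a: "a \<in> carrier R"
  defines "U \<equiv> {a [^] (n::nat) \<otimes> s | n s. s \<in> T}"
  shows "submonoid U R" and "T \<subseteq> U" and "a \<in> U"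
proof -
  interpret T: submonoid T R by fact
  note Tc = T.subset[THEN subsetD]
  show TU: "T \<subseteq> U"
  proof
    fix s assume "s \<in> T"
    then have "s = a [^] (0::nat) \<otimes> s" using Tc by simp
    with \<open>s \<in> T\<close> show "s \<in> U" unfolding U_def by blast
  qed
  have "a = a [^] (1::nat) \<otimes> \<one>" using a by simp
  then show "a \<in> U" unfolding U_def using T.one_closed by (intro CollectI exI conjI)
  show "submonoid U R"
  proof
    show "U \<subseteq> carrier R" unfolding U_def using a Tc by auto
    show "\<one> \<in> U" using TU by auto
    fix x y assume "x \<in> U" "y \<in> U"
    then obtain n s m t where *: "x = a [^] (n::nat) \<otimes> s" "s \<in> T" "y = a [^] (m::nat) \<otimes> t" "t \<in> T"
      unfolding U_def by blast
    have "x \<otimes> y = a [^] (n + m) \<otimes> (s \<otimes> t)"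
      using * a Tc by (simp add: nat_pow_mult[symmetric] m_ac)
    with * show "x \<otimes> y \<in> U" unfolding U_def by blast
  qed
qed

text \<open>Maximality says exactly that \<open>a \<notin> T\<close> iff \<open>a\<^sup>n s = 0\<close> for some \<open>n\<close> and some \<open>s \<in> T\<close>: otherwise
  \<open>a\<close> could be adjoined to \<open>T\<close>. The nontrivial point is that this condition is additive in \<open>a\<close>.
  A prime contained in the complement of \<open>T\<close> has a complement that contains \<open>T\<close>, hence equals it.\<close>

lemma (in cring) complement_of_maximal_submonoid:
  assumes T: "submonoid T R" and zero: "\<zero> \<notin> T"
    and max: "\<And>U. \<lbrakk>submonoid U R; T \<subseteq> U; \<zero> \<notin> U\<rbrakk> \<Longrightarrow> U = T"
  shows "minimal_prime (carrier R - T) R"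
proof -
  interpret T: submonoid T R by fact
  note Tc = T.subset[THEN subsetD]
  have kill: "\<exists>(n::nat). \<exists>s\<in>T. a [^] n \<otimes> s = \<zero>" if "a \<in> carrier R" "a \<notin> T" for a
  proof (rule ccontr)
    assume "\<not> ?thesis"
    then have "\<zero> \<notin> {a [^] (n::nat) \<otimes> s | n s. s \<in> T}" by force
    with max[OF submonoid_adjoin(1,2)[OF T that(1)]] submonoid_adjoin(3)[OF T that(1)] that
    show False by blast
  qed
  have Tpow: "u [^] (n::nat) \<in> T" if "u \<in> T" for u n
    using that by (induction n) auto
  have mult: "r \<otimes> a \<in> carrier R - T" if a: "a \<in> carrier R - T" and "r \<in> carrier R" for a r
  proof -
    obtain n :: nat and s where ns: "s \<in> T" "a [^] n \<otimes> s = \<zero>" using kill[of a] a by auto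
    have "(r \<otimes> a) [^] n \<otimes> s = \<zero>"
      using that ns Tc by (simp add: nat_pow_distrib m_assoc)
    then have "r \<otimes> a \<notin> T" using T.m_closed[OF Tpow ns(1), of "r \<otimes> a" n] zero by auto
    then show ?thesis using that by auto
  qed
  have add: "a \<oplus> b \<in> carrier R - T" if a: "a \<in> carrier R - T" and b: "b \<in> carrier R - T" for a b
  proof -
    have ca: "a \<in> carrier R" and cb: "b \<in> carrier R" using a b by auto
    obtain m :: nat and t where t: "t \<in> T" "b [^] m \<otimes> t = \<zero>" using kill[of b] b by auto
    have "a \<oplus> b \<notin> T"
    proof
      assume u: "a \<oplus> b \<in> T"
      \<comment> \<open>On an element annihilated by \<open>a\<close>, multiplication by \<open>a + b\<close> is multiplication by \<open>b\<close>;
        this trades one factor \<open>a\<close> for a factor in \<open>T\<close>.\<close>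
      have "a [^] n \<otimes> s \<noteq> \<zero>" if "s \<in> T" for n :: nat and s
        using that
      proof (induction n arbitrary: s)
        case 0
        then show ?case using zero Tc by auto
      next
        case (Suc n)
        show ?case
        proof
          assume z: "a [^] Suc n \<otimes> s = \<zero>"
          define w where "w = a [^] n \<otimes> s"
          have w: "w \<in> carrier R" "a \<otimes> w = \<zero>"
            using z Suc.prems Tc ca by (auto simp: w_def m_ac)
          have pow: "(a \<oplus> b) [^] k \<otimes> w = b [^] k \<otimes> w" for k :: nat
          proof (induction k)
            case (Suc k)
            have "(a \<oplus> b) [^] Suc k \<otimes> w = (a \<oplus> b) \<otimes> ((a \<oplus> b) [^] k \<otimes> w)"
              using ca cb w by (simp add: m_ac)
            also have "\<dots> = a \<otimes> (b [^] k \<otimes> w) \<oplus> b \<otimes> (b [^] k \<otimes> w)"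
              using ca cb w(1) by (simp add: Suc.IH l_distr)
            also have "\<dots> = b [^] k \<otimes> (a \<otimes> w) \<oplus> b [^] Suc k \<otimes> w"
              using ca cb w(1) by (simp add: m_ac)
            finally show ?case using ca cb w by simp
          qed simp
          have "a [^] n \<otimes> ((a \<oplus> b) [^] m \<otimes> s \<otimes> t) = (a \<oplus> b) [^] m \<otimes> w \<otimes> t"
            using ca cb Tc[OF t(1)] Tc[OF Suc.prems] by (simp add: w_def m_ac)
          also have "\<dots> = b [^] m \<otimes> t \<otimes> w"
            unfolding pow using cb w(1) Tc[OF t(1)] by (simp add: m_ac)
          finally show False
            using Suc.IH[of "(a \<oplus> b) [^] m \<otimes> s \<otimes> t"] Tpow[OF u] Suc.prems t w by simp
        qed
      qed
      then show False using kill[of a] a by auto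
    qed
    then show ?thesis using ca cb by auto
  qed
  have "primeideal (carrier R - T) R"
  proof (rule primeidealI2)
    show "cring R" by (rule is_cring)
    have "\<zero> \<in> carrier R - T" using zero by auto
    moreover have "\<ominus> a \<in> carrier R - T" if "a \<in> carrier R - T" for a
      using mult[OF that, of "\<ominus> \<one>"] that by (simp add: l_minus)
    ultimately show "additive_subgroup (carrier R - T) R"
      using add
      by (intro additive_subgroup.intro subgroup.intro) (auto simp: a_inv_def)
    show "x \<otimes> a \<in> carrier R - T" if "a \<in> carrier R - T" "x \<in> carrier R" for a x
      using mult that by blast
    then show "a \<otimes> x \<in> carrier R - T" if "a \<in> carrier R - T" "x \<in> carrier R" for a x
      using that m_comm by (metis DiffD1)
    show "carrier R \<noteq> carrier R - T" using T.one_closed by blast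
    show "a \<in> carrier R - T \<or> b \<in> carrier R - T"
      if "a \<in> carrier R" "b \<in> carrier R" "a \<otimes> b \<in> carrier R - T" for a b
      using that T.m_closed by blast
  qed
  moreover have "Q = carrier R - T" if Q: "primeideal Q R" "Q \<subseteq> carrier R - T" for Q
  proof -
    interpret Q: primeideal Q R by fact
    have "submonoid (carrier R - Q) R"
      using Q.I_prime Q.I_notcarr Q.one_imp_carrier
      by (intro submonoid.intro) auto
    moreover have "T \<subseteq> carrier R - Q" using Q Tc by auto
    ultimately have "carrier R - Q = T" using max Q.zero_closed by auto
    then show ?thesis using Q.a_subset by blast
  qed
  ultimately show ?thesis unfolding minimal_prime_def by blast
qed

text \<open>By Zorn's lemma \<open>S\<close> lies in a submonoid that is maximal among those avoiding \<open>0\<close>. One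
  application yields a prime that is minimal already, without a separate descent among primes.\<close>

lemma (in cring) minimal_prime_avoiding:
  assumes S: "submonoid S R" "\<zero> \<notin> S"
  shows "\<exists>P. minimal_prime P R \<and> P \<inter> S = {}"
proof -
  let ?A = "{T. submonoid T R \<and> S \<subseteq> T \<and> \<zero> \<notin> T}"
  have "\<exists>T\<in>?A. \<forall>U\<in>?A. T \<subseteq> U \<longrightarrow> U = T"
  proof (rule subset_Zorn_nonempty)
    show "?A \<noteq> {}" using S by blast
    fix C assume ne: "C \<noteq> {}" and chain: "subset.chain ?A C"
    then have C: "\<And>T. T \<in> C \<Longrightarrow> submonoid T R \<and> S \<subseteq> T \<and> \<zero> \<notin> T"
      unfolding subset.chain_def by blast
    have "submonoid (\<Union>C) R"
    proof
      show "\<Union>C \<subseteq> carrier R" using C submonoid.subset by blast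
      show "\<one> \<in> \<Union>C" using C ne submonoid.one_closed by fastforce
      fix x y assume "x \<in> \<Union>C" "y \<in> \<Union>C"
      then obtain V W where VW: "x \<in> V" "V \<in> C" "y \<in> W" "W \<in> C" by blast
      then have "V \<subseteq> W \<or> W \<subseteq> V" using chain unfolding subset.chain_def by blast
      then have "\<exists>Z\<in>C. x \<in> Z \<and> y \<in> Z" using VW by blast
      then show "x \<otimes> y \<in> \<Union>C" using C submonoid.m_closed by (metis UnionI)
    qed
    then show "\<Union>C \<in> ?A" using C ne by blast
  qed
  then obtain T where "T \<in> ?A" and max: "\<forall>U\<in>?A. T \<subseteq> U \<longrightarrow> U = T" by (rule bexE)
  then have T: "submonoid T R" "S \<subseteq> T" "\<zero> \<notin> T" by auto
  have "minimal_prime (carrier R - T) R"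
  proof (rule complement_of_maximal_submonoid[OF T(1,3)])
    fix U assume "submonoid U R" "T \<subseteq> U" "\<zero> \<notin> U"
    with T(2) show "U = T" by (intro max[rule_format]) auto
  qed
  moreover have "(carrier R - T) \<inter> S = {}" using T by auto
  ultimately show ?thesis by blast
qed

text \<open>If a nonzerodivisor \<open>c\<close> lay in a minimal prime \<open>P\<close>, then the submonoid generated by \<open>c\<close> and
  the complement of \<open>P\<close> would avoid \<open>0\<close>, and a prime disjoint from it would be strictly
  smaller than \<open>P\<close>.\<close>

lemma nonzerodivisor_off_minimal_primes:
  "nonzerodivisors R \<subseteq> off_minimal_primes R"
proof
  fix c assume c: "c \<in> nonzerodivisors R"
  have "c \<notin> P" if P: "minimal_prime P R" for P
  proof
    assume "c \<in> P"
    interpret P: primeideal P R using P unfolding minimal_prime_def by blast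
    have cc: "c \<in> carrier R" and reg: "\<And>x. \<lbrakk>x \<in> carrier R; c \<otimes>\<^bsub>R\<^esub> x = \<zero>\<^bsub>R\<^esub>\<rbrakk> \<Longrightarrow> x = \<zero>\<^bsub>R\<^esub>"
      using c unfolding nonzerodivisors_def by auto
    have T: "submonoid (carrier R - P) R"
      using P.I_prime P.I_notcarr P.one_imp_carrier by (intro submonoid.intro) auto
    let ?U = "{c [^]\<^bsub>R\<^esub> n \<otimes>\<^bsub>R\<^esub> s | (n::nat) s. s \<in> carrier R - P}"
    have powreg: "s = \<zero>\<^bsub>R\<^esub>" if "s \<in> carrier R" "c [^]\<^bsub>R\<^esub> n \<otimes>\<^bsub>R\<^esub> s = \<zero>\<^bsub>R\<^esub>" for n :: nat and s
      using that
    proof (induction n)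
      case (Suc n)
      have "c \<otimes>\<^bsub>R\<^esub> (c [^]\<^bsub>R\<^esub> n \<otimes>\<^bsub>R\<^esub> s) = \<zero>\<^bsub>R\<^esub>"
        using Suc.prems cc by (simp add: P.m_ac)
      then show ?case using Suc.IH Suc.prems(1) reg[of "c [^]\<^bsub>R\<^esub> n \<otimes>\<^bsub>R\<^esub> s"] cc by simp
    qed simp
    have "\<zero>\<^bsub>R\<^esub> \<notin> ?U"
    proof
      assume "\<zero>\<^bsub>R\<^esub> \<in> ?U"
      then obtain n :: nat and s where s: "s \<in> carrier R - P" "c [^]\<^bsub>R\<^esub> n \<otimes>\<^bsub>R\<^esub> s = \<zero>\<^bsub>R\<^esub>"
        by force
      then have "s = \<zero>\<^bsub>R\<^esub>" by (intro powreg[of s n]) auto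
      with s(1) show False using P.zero_closed by simp
    qed
    then have "\<exists>Q. minimal_prime Q R \<and> Q \<inter> ?U = {}"
      by (rule P.minimal_prime_avoiding[OF P.submonoid_adjoin(1)[OF T cc]])
    then obtain Q where Q: "minimal_prime Q R" "Q \<inter> ?U = {}" by (elim exE conjE)
    have "Q \<subseteq> carrier R" using Q(1) P.is_ideal unfolding minimal_prime_def
      by (meson additive_subgroup.a_subset ideal_def primeideal_def)
    then have "Q \<subseteq> P" using Q(2) P.submonoid_adjoin(2)[OF T cc] by blast
    then have "Q = P" using P Q(1) unfolding minimal_prime_def by blast
    then show False using Q(2) P.submonoid_adjoin(3)[OF T cc] \<open>c \<in> P\<close> by blast
  qed
  then show "c \<in> off_minimal_primes R"
    using c unfolding off_minimal_primes_def nonzerodivisors_def by blast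
qed

text \<open>In a reduced ring the powers of \<open>x \<noteq> 0\<close> avoid \<open>0\<close>, so some minimal prime misses \<open>x\<close>; it
  contains every \<open>c\<close> with \<open>c x = 0\<close>.\<close>

lemma (in cring) off_minimal_primes_reduced:
  assumes "reduced_ring R"
  shows "off_minimal_primes R = nonzerodivisors R"
proof
  show "nonzerodivisors R \<subseteq> off_minimal_primes R" by (rule nonzerodivisor_off_minimal_primes)
  show "off_minimal_primes R \<subseteq> nonzerodivisors R"
  proof
    fix c assume c: "c \<in> off_minimal_primes R"
    have "x = \<zero>" if x: "x \<in> carrier R" "c \<otimes> x = \<zero>" for x
    proof (rule ccontr)
      assume "x \<noteq> \<zero>"
      let ?S = "{x [^] (n::nat) \<otimes> s | n s. s \<in> {\<one>}}"
      have one: "submonoid {\<one>} R" by (rule submonoid.intro) auto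
      have "\<zero> \<notin> ?S"
        using assms x(1) \<open>x \<noteq> \<zero>\<close> unfolding reduced_ring_def by (force simp: eq_commute)
      then have "\<exists>P. minimal_prime P R \<and> P \<inter> ?S = {}"
        by (rule minimal_prime_avoiding[OF submonoid_adjoin(1)[OF one x(1)]])
      then obtain P where P: "minimal_prime P R" "P \<inter> ?S = {}" by (elim exE conjE)
      then interpret P: primeideal P R unfolding minimal_prime_def by blast
      have "x \<notin> P" using P submonoid_adjoin(3)[OF one x(1)] by blast
      moreover have "c \<otimes> x \<in> P" using x by (simp add: P.zero_closed)
      ultimately have "c \<in> P" using P.I_prime x c unfolding off_minimal_primes_def by blast
      then show False using c P(1) unfolding off_minimal_primes_def by blast
    qed
    then show "c \<in> nonzerodivisors R"
      using c unfolding nonzerodivisors_def off_minimal_primes_def by blast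
  qed
qed

section \<open>The normalization and its conductor\<close>

locale fraction_ring = R: cring R for R (structure) +
  fixes K (structure) and \<iota>
  assumes fractions: "total_ring_of_fractions R K \<iota>"

sublocale fraction_ring \<subseteq> ring_hom_cring R K \<iota>
  using fractions R.is_cring
  unfolding total_ring_of_fractions_def ring_hom_cring_def ring_hom_cring_axioms_def by blast

context fraction_ring
begin

abbreviation "imR \<equiv> \<iota> ` carrier R"

lemma \<iota>_inj: "\<lbrakk>\<iota> a = \<iota> b; a \<in> carrier R; b \<in> carrier R\<rbrakk> \<Longrightarrow> a = b"
  using fractions unfolding total_ring_of_fractions_def inj_on_def by blast

lemma \<iota>_unit: "s \<in> nonzerodivisors R \<Longrightarrow> \<iota> s \<in> Units K"
  using fractions unfolding total_ring_of_fractions_def by blast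

lemma imR_neg_finsum:
  fixes f :: "nat \<Rightarrow> _"
  assumes "\<And>i. i < n \<Longrightarrow> f i \<in> imR"
  shows "\<ominus>\<^bsub>K\<^esub> (\<Oplus>\<^bsub>K\<^esub>i\<in>{..<n}. f i) \<in> imR"
proof -
  have "\<forall>i\<in>{..<n}. \<exists>b. b \<in> carrier R \<and> f i = \<iota> b" using assms by blast
  from bchoice[OF this] obtain b where b: "\<And>i. i < n \<Longrightarrow> b i \<in> carrier R \<and> f i = \<iota> (b i)" by auto
  have "\<ominus>\<^bsub>K\<^esub> (\<Oplus>\<^bsub>K\<^esub>i\<in>{..<n}. f i) = \<ominus>\<^bsub>K\<^esub> (\<Oplus>\<^bsub>K\<^esub>i\<in>{..<n}. \<iota> (b i))"
    using b by (intro arg_cong[of _ _ "a_inv K"] S.finsum_cong') auto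
  also have "\<dots> = \<iota> (\<ominus>\<^bsub>R\<^esub> (\<Oplus>\<^bsub>R\<^esub>i\<in>{..<n}. b i))"
    using b by (subst hom_a_inv) (auto intro!: R.finsum_closed simp: hom_finsum o_def)
  finally show ?thesis using b by (metis (no_types, lifting) R.a_inv_closed R.finsum_closed Pi_I imageI lessThan_iff)
qed

text \<open>An element integral of degree \<open>n\<close> has a common denominator for all of its powers: modulo the
  integral equation only the first \<open>n\<close> powers matter, and those have the denominator \<open>s\<^sup>n\<close>.\<close>

lemma integral_bounded_denominator:
  assumes int: "integral_over R K \<iota> y" and y: "y \<in> carrier K"
    and s: "s \<in> carrier R" and sy: "\<iota> s \<otimes>\<^bsub>K\<^esub> y \<in> imR"
  shows "\<exists>n::nat. \<forall>m::nat. \<iota> (s [^]\<^bsub>R\<^esub> n) \<otimes>\<^bsub>K\<^esub> y [^]\<^bsub>K\<^esub> m \<in> imR"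
proof -
  obtain n :: nat and c where c: "\<And>i. i < n \<Longrightarrow> c i \<in> carrier R"
    and eq: "y [^]\<^bsub>K\<^esub> n \<oplus>\<^bsub>K\<^esub> (\<Oplus>\<^bsub>K\<^esub>i\<in>{..<n}. \<iota> (c i) \<otimes>\<^bsub>K\<^esub> y [^]\<^bsub>K\<^esub> i) = \<zero>\<^bsub>K\<^esub>"
    using int unfolding integral_over_def by auto
  obtain a where a: "a \<in> carrier R" "\<iota> s \<otimes>\<^bsub>K\<^esub> y = \<iota> a" using sy by blast
  let ?d = "\<iota> (s [^]\<^bsub>R\<^esub> n)"
  have d: "?d \<in> carrier K" using s by simp
  have "?d \<otimes>\<^bsub>K\<^esub> y [^]\<^bsub>K\<^esub> m \<in> imR" for m :: nat
  proof (induction m rule: less_induct)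
    case (less m)
    show ?case
    proof (cases "m < n")
      case True
      then have "s [^]\<^bsub>R\<^esub> n = s [^]\<^bsub>R\<^esub> (n - m) \<otimes>\<^bsub>R\<^esub> s [^]\<^bsub>R\<^esub> m"
        using s by (simp add: R.nat_pow_mult)
      then have "?d \<otimes>\<^bsub>K\<^esub> y [^]\<^bsub>K\<^esub> m = \<iota> (s [^]\<^bsub>R\<^esub> (n - m)) \<otimes>\<^bsub>K\<^esub> (\<iota> s \<otimes>\<^bsub>K\<^esub> y) [^]\<^bsub>K\<^esub> m"
        using s y by (simp add: S.nat_pow_distrib S.m_assoc)
      also have "\<dots> = \<iota> (s [^]\<^bsub>R\<^esub> (n - m) \<otimes>\<^bsub>R\<^esub> a [^]\<^bsub>R\<^esub> m)"
        using a s by simp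
      finally show ?thesis using a s by blast
    next
      case False
      let ?f = "\<lambda>i. \<iota> (c i) \<otimes>\<^bsub>K\<^esub> y [^]\<^bsub>K\<^esub> i" and ?e = "?d \<otimes>\<^bsub>K\<^esub> y [^]\<^bsub>K\<^esub> (m - n)"
      have f: "?f \<in> {..<n} \<rightarrow> carrier K" using c y by auto
      have e: "?e \<in> carrier K" using d y by simp
      have "y [^]\<^bsub>K\<^esub> m = y [^]\<^bsub>K\<^esub> (m - n) \<otimes>\<^bsub>K\<^esub> y [^]\<^bsub>K\<^esub> n"
        using False y by (simp add: S.nat_pow_mult)
      then have "?d \<otimes>\<^bsub>K\<^esub> y [^]\<^bsub>K\<^esub> m = ?e \<otimes>\<^bsub>K\<^esub> y [^]\<^bsub>K\<^esub> n"
        using d y by (simp add: S.m_assoc)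
      also have "y [^]\<^bsub>K\<^esub> n = \<ominus>\<^bsub>K\<^esub> (\<Oplus>\<^bsub>K\<^esub>i\<in>{..<n}. ?f i)"
        using eq y f by (intro S.minus_equality[symmetric]) (auto simp: S.a_comm)
      also have "?e \<otimes>\<^bsub>K\<^esub> \<dots> = \<ominus>\<^bsub>K\<^esub> (\<Oplus>\<^bsub>K\<^esub>i\<in>{..<n}. ?e \<otimes>\<^bsub>K\<^esub> ?f i)"
        using f e S.finsum_rdistr[of "{..<n}" ?e ?f] by (simp add: S.r_minus)
      also have "\<dots> \<in> imR"
      proof (rule imR_neg_finsum)
        fix i assume i: "i < n"
        have "m - n + i < m" using i False by linarith
        from less.IH[OF this] obtain b
          where b: "b \<in> carrier R" "?d \<otimes>\<^bsub>K\<^esub> y [^]\<^bsub>K\<^esub> (m - n + i) = \<iota> b" by blast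
        have "?e \<otimes>\<^bsub>K\<^esub> ?f i = \<iota> (c i) \<otimes>\<^bsub>K\<^esub> (?d \<otimes>\<^bsub>K\<^esub> y [^]\<^bsub>K\<^esub> (m - n + i))"
          using c[OF i] d y by (simp add: S.nat_pow_mult[symmetric] S.m_ac)
        then have "?e \<otimes>\<^bsub>K\<^esub> ?f i = \<iota> (c i \<otimes>\<^bsub>R\<^esub> b)" using c[OF i] b by simp
        with b(1) c[OF i] show "?e \<otimes>\<^bsub>K\<^esub> ?f i \<in> imR" by blast
      qed
      finally show ?thesis .
    qed
  qed
  then show ?thesis by blast
qed

lemma integral_scale:
  assumes int: "integral_over R K \<iota> y" and y: "y \<in> carrier K" and s: "s \<in> carrier R"
  shows "integral_over R K \<iota> (\<iota> s \<otimes>\<^bsub>K\<^esub> y)"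
proof -
  obtain n :: nat and c where c: "\<And>i. i < n \<Longrightarrow> c i \<in> carrier R"
    and eq: "y [^]\<^bsub>K\<^esub> n \<oplus>\<^bsub>K\<^esub> (\<Oplus>\<^bsub>K\<^esub>i\<in>{..<n}. \<iota> (c i) \<otimes>\<^bsub>K\<^esub> y [^]\<^bsub>K\<^esub> i) = \<zero>\<^bsub>K\<^esub>"
    using int unfolding integral_over_def by auto
  let ?f = "\<lambda>i. \<iota> (c i) \<otimes>\<^bsub>K\<^esub> y [^]\<^bsub>K\<^esub> i" and ?d = "\<iota> s [^]\<^bsub>K\<^esub> n" and ?sy = "\<iota> s \<otimes>\<^bsub>K\<^esub> y"
  let ?c = "\<lambda>i. s [^]\<^bsub>R\<^esub> (n - i) \<otimes>\<^bsub>R\<^esub> c i"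
  have f: "?f \<in> {..<n} \<rightarrow> carrier K" using c y by auto
  have d: "?d \<in> carrier K" using s by simp
  have "(\<Oplus>\<^bsub>K\<^esub>i\<in>{..<n}. \<iota> (?c i) \<otimes>\<^bsub>K\<^esub> ?sy [^]\<^bsub>K\<^esub> i) = (\<Oplus>\<^bsub>K\<^esub>i\<in>{..<n}. ?d \<otimes>\<^bsub>K\<^esub> ?f i)"
  proof (rule S.finsum_cong')
    fix i assume "i \<in> {..<n}"
    then have i: "i < n" by simp
    then have "?d = \<iota> s [^]\<^bsub>K\<^esub> (n - i) \<otimes>\<^bsub>K\<^esub> \<iota> s [^]\<^bsub>K\<^esub> i"
      using s by (simp add: S.nat_pow_mult)
    then show "\<iota> (?c i) \<otimes>\<^bsub>K\<^esub> ?sy [^]\<^bsub>K\<^esub> i = ?d \<otimes>\<^bsub>K\<^esub> ?f i"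
      using c[OF i] s y by (simp add: S.nat_pow_distrib S.m_ac)
  qed (use f d in auto)
  also have "\<dots> = ?d \<otimes>\<^bsub>K\<^esub> (\<Oplus>\<^bsub>K\<^esub>i\<in>{..<n}. ?f i)"
    using f d by (simp add: S.finsum_rdistr)
  finally have "?sy [^]\<^bsub>K\<^esub> n \<oplus>\<^bsub>K\<^esub> (\<Oplus>\<^bsub>K\<^esub>i\<in>{..<n}. \<iota> (?c i) \<otimes>\<^bsub>K\<^esub> ?sy [^]\<^bsub>K\<^esub> i)
      = ?d \<otimes>\<^bsub>K\<^esub> (y [^]\<^bsub>K\<^esub> n \<oplus>\<^bsub>K\<^esub> (\<Oplus>\<^bsub>K\<^esub>i\<in>{..<n}. ?f i))"
    using s y d f by (simp add: S.nat_pow_distrib S.r_distr)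
  also have "\<dots> = \<zero>\<^bsub>K\<^esub>" using eq d by simp
  finally show ?thesis
    unfolding integral_over_def using c s by (intro exI[of _ n] exI[of _ ?c]) auto
qed

lemma integral_\<iota>:
  assumes x: "x \<in> carrier R"
  shows "integral_over R K \<iota> (\<iota> x)"
  unfolding integral_over_def
proof (intro exI conjI)
  have "{..<1::nat} = {0}" by auto
  then show "\<iota> x [^]\<^bsub>K\<^esub> (1::nat) \<oplus>\<^bsub>K\<^esub> (\<Oplus>\<^bsub>K\<^esub>i\<in>{..<1::nat}. \<iota> (\<ominus>\<^bsub>R\<^esub> x) \<otimes>\<^bsub>K\<^esub> \<iota> x [^]\<^bsub>K\<^esub> i) = \<zero>\<^bsub>K\<^esub>"
    using x by (simp add: S.r_neg)
qed (use x in auto)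

lemma carrier_normalization:
  "carrier (normalization R K \<iota>) = {y \<in> carrier K. integral_over R K \<iota> y}"
  by (simp add: normalization_def)

lemma nonzerodivisor_pow:
  assumes "s \<in> nonzerodivisors R" shows "s [^]\<^bsub>R\<^esub> (n::nat) \<in> nonzerodivisors R"
proof (induction n)
  case (Suc n)
  have s: "s \<in> carrier R" using assms unfolding nonzerodivisors_def by blast
  have "x = \<zero>\<^bsub>R\<^esub>" if x: "x \<in> carrier R" and z: "s [^]\<^bsub>R\<^esub> Suc n \<otimes>\<^bsub>R\<^esub> x = \<zero>\<^bsub>R\<^esub>" for x
  proof -
    have "s [^]\<^bsub>R\<^esub> n \<otimes>\<^bsub>R\<^esub> (s \<otimes>\<^bsub>R\<^esub> x) = \<zero>\<^bsub>R\<^esub>" using z s x by (simp add: R.m_assoc)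
    then have "s \<otimes>\<^bsub>R\<^esub> x = \<zero>\<^bsub>R\<^esub>" using Suc.IH s x unfolding nonzerodivisors_def by simp
    then show ?thesis using assms x unfolding nonzerodivisors_def by simp
  qed
  then show ?case using s unfolding nonzerodivisors_def by simp
qed (simp add: nonzerodivisors_def)

text \<open>If \<open>y = a/s\<close> is integral over \<open>R\<close>, then \<open>a\<close> lies in the tight closure of \<open>sR\<close>: with \<open>s\<^sup>n\<close> a
  common denominator of the powers of \<open>y\<close>, we have \<open>s\<^sup>n a\<^sup>q = (s\<^sup>n y\<^sup>q) s\<^sup>q \<in> s\<^sup>q R\<close>. Hence an \<open>r\<close> in the test
  ideal satisfies \<open>r a \<in> sR\<close>, that is, \<open>r y \<in> R\<close>.\<close>

lemma finitistic_test_ideal_subset_conductor: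
  "finitistic_test_ideal p R \<subseteq> conductor R K \<iota>"
proof
  fix r assume r: "r \<in> finitistic_test_ideal p R"
  have test: "r \<in> carrier R \<and> (\<forall>x\<in>tight_closure p R I. r \<otimes>\<^bsub>R\<^esub> x \<in> I)" if "ideal I R" for I
    using r that unfolding finitistic_test_ideal_def ideal_colon_def by blast
  have rc: "r \<in> carrier R" using test[OF R.oneideal] by blast
  have "\<iota> r \<otimes>\<^bsub>K\<^esub> y \<in> imR" if "y \<in> carrier (normalization R K \<iota>)" for y
  proof -
    have y: "y \<in> carrier K" "integral_over R K \<iota> y" using that by (auto simp: carrier_normalization)
    obtain a s where as: "a \<in> carrier R" "s \<in> nonzerodivisors R" "y = \<iota> a \<otimes>\<^bsub>K\<^esub> inv\<^bsub>K\<^esub> (\<iota> s)"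
      using fractions y(1) unfolding total_ring_of_fractions_def by blast
    have s: "s \<in> carrier R" using as(2) unfolding nonzerodivisors_def by blast
    have u: "\<iota> s \<in> Units K" using \<iota>_unit as(2) by blast
    have sy: "\<iota> s \<otimes>\<^bsub>K\<^esub> y = \<iota> a"
      using as u s by (simp add: S.m_lcomm)
    then have "\<exists>n::nat. \<forall>m::nat. \<iota> (s [^]\<^bsub>R\<^esub> n) \<otimes>\<^bsub>K\<^esub> y [^]\<^bsub>K\<^esub> m \<in> imR"
      using integral_bounded_denominator[OF y(2,1) s] as(1) by auto
    then obtain n :: nat where n: "\<And>m::nat. \<iota> (s [^]\<^bsub>R\<^esub> n) \<otimes>\<^bsub>K\<^esub> y [^]\<^bsub>K\<^esub> m \<in> imR" by blast
    define I where "I = PIdl\<^bsub>R\<^esub> s"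
    have I: "ideal I R" "s \<in> I"
      unfolding I_def using s R.cgenideal_ideal R.cgenideal_self by auto
    have "s [^]\<^bsub>R\<^esub> n \<otimes>\<^bsub>R\<^esub> a [^]\<^bsub>R\<^esub> q \<in> frobenius_power R I q" for q :: nat
    proof -
      from n[of q] obtain b
        where b: "\<iota> (s [^]\<^bsub>R\<^esub> n) \<otimes>\<^bsub>K\<^esub> y [^]\<^bsub>K\<^esub> q = \<iota> b" "b \<in> carrier R" by (rule imageE)
      have "\<iota> (s [^]\<^bsub>R\<^esub> n \<otimes>\<^bsub>R\<^esub> a [^]\<^bsub>R\<^esub> q) = \<iota> (s [^]\<^bsub>R\<^esub> n) \<otimes>\<^bsub>K\<^esub> (\<iota> s \<otimes>\<^bsub>K\<^esub> y) [^]\<^bsub>K\<^esub> q"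
        using as(1) s by (simp add: sy)
      also have "\<dots> = (\<iota> (s [^]\<^bsub>R\<^esub> n) \<otimes>\<^bsub>K\<^esub> y [^]\<^bsub>K\<^esub> q) \<otimes>\<^bsub>K\<^esub> \<iota> s [^]\<^bsub>K\<^esub> q"
        using s y(1) by (simp add: S.nat_pow_distrib S.m_ac)
      also have "\<dots> = \<iota> (b \<otimes>\<^bsub>R\<^esub> s [^]\<^bsub>R\<^esub> q)"
        unfolding b(1) using b(2) s by simp
      finally have *: "s [^]\<^bsub>R\<^esub> n \<otimes>\<^bsub>R\<^esub> a [^]\<^bsub>R\<^esub> q = b \<otimes>\<^bsub>R\<^esub> s [^]\<^bsub>R\<^esub> q"
        by (rule \<iota>_inj) (use as(1) s b(2) in auto)
      have sub: "(\<lambda>x. x [^]\<^bsub>R\<^esub> q) ` I \<subseteq> carrier R"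
        using ideal.Icarr[OF I(1)] by auto
      interpret F: ideal "frobenius_power R I q" R
        unfolding frobenius_power_def using sub by (rule R.genideal_ideal)
      have "s [^]\<^bsub>R\<^esub> q \<in> frobenius_power R I q"
        unfolding frobenius_power_def using R.genideal_self[OF sub] I(2) by blast
      then show ?thesis unfolding * using b(2) F.I_l_closed by blast
    qed
    then have "\<forall>\<^sub>F e in sequentially. s [^]\<^bsub>R\<^esub> n \<otimes>\<^bsub>R\<^esub> a [^]\<^bsub>R\<^esub> (p ^ e) \<in> frobenius_power R I (p ^ e)"
      by simp
    moreover have "s [^]\<^bsub>R\<^esub> n \<in> off_minimal_primes R"
      by (rule subsetD[OF nonzerodivisor_off_minimal_primes nonzerodivisor_pow[OF as(2)]])
    ultimately have "a \<in> tight_closure p R I"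
      unfolding tight_closure_def using as(1) by (intro CollectI conjI bexI)
    then have "r \<otimes>\<^bsub>R\<^esub> a \<in> PIdl\<^bsub>R\<^esub> s" using test[OF I(1)] unfolding I_def by blast
    then obtain d where d: "d \<in> carrier R" "r \<otimes>\<^bsub>R\<^esub> a = d \<otimes>\<^bsub>R\<^esub> s"
      unfolding cgenideal_def by blast
    have "\<iota> r \<otimes>\<^bsub>K\<^esub> y = \<iota> (r \<otimes>\<^bsub>R\<^esub> a) \<otimes>\<^bsub>K\<^esub> inv\<^bsub>K\<^esub> (\<iota> s)"
      using as(1,3) u rc by (simp add: S.m_assoc)
    also have "\<dots> = \<iota> d"
      unfolding d(2) using d(1) s u by (simp add: S.m_assoc)
    finally show ?thesis using d(1) by blast
  qed
  then show "r \<in> conductor R K \<iota>" unfolding conductor_def using rc by blast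
qed

end

section \<open>The Frobenius and the modules it defines\<close>

lemma (in cring) binomial:
  assumes a: "a \<in> carrier R" and b: "b \<in> carrier R"
  shows "(a \<oplus> b) [^] n = (\<Oplus>k\<in>{..n}. [(n choose k)] \<cdot> (a [^] k \<otimes> b [^] (n - k)))"
proof (induction n)
  case 0
  then show ?case by (simp add: a b)
next
  case (Suc n)
  let ?g = "\<lambda>n k. [(n choose k)] \<cdot> (a [^] k \<otimes> b [^] (n - k))"
  let ?v = "\<lambda>k. [(n choose k)] \<cdot> (a [^] k \<otimes> b [^] (Suc n - k))"
  let ?G = "finsum R (?g n) {..n}"
  have G: "?G \<in> carrier R" using a b by (intro finsum_closed) auto
  have ga: "(\<Oplus>k\<in>{..n}. a \<otimes> ?g n k) = a \<otimes> ?G"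
    using a b by (subst finsum_rdistr) auto
  have gb: "(\<Oplus>k\<in>{..n}. b \<otimes> ?g n k) = b \<otimes> ?G"
    using a b by (subst finsum_rdistr) auto
  \<comment> \<open>\<open>?v\<close> lists the terms of \<open>b (a + b)\<^sup>n\<close>, padded by a zero term at \<open>k = n + 1\<close>, so that Pascal's rule
    can be applied to all terms alike.\<close>
  have "(\<Oplus>k\<in>{..n}. ?v (Suc k)) \<oplus> ?v 0 = finsum R ?v {..Suc n}"
    using a b by (subst finsum_Suc2) auto
  also have "\<dots> = finsum R ?v {..n}"
    using a b by (subst finsum_Suc) (auto simp: binomial_eq_0)
  also have "\<dots> = (\<Oplus>k\<in>{..n}. b \<otimes> ?g n k)"
    using a b by (intro finsum_cong') (auto simp: Suc_diff_le add_pow_rdistr m_ac)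
  finally have v: "(\<Oplus>k\<in>{..n}. ?v (Suc k)) \<oplus> ?v 0 = b \<otimes> ?G" unfolding gb .
  have "finsum R (?g (Suc n)) {..Suc n} = (\<Oplus>k\<in>{..n}. ?g (Suc n) (Suc k)) \<oplus> ?g (Suc n) 0"
    using a b by (subst finsum_Suc2) auto
  also have "(\<Oplus>k\<in>{..n}. ?g (Suc n) (Suc k)) = (\<Oplus>k\<in>{..n}. a \<otimes> ?g n k \<oplus> ?v (Suc k))"
    using a b by (intro finsum_cong') (auto simp: add_pow_rdistr add.nat_pow_mult[symmetric] m_ac)
  also have "\<dots> = a \<otimes> ?G \<oplus> (\<Oplus>k\<in>{..n}. ?v (Suc k))"
    using a b by (subst finsum_addf) (auto simp: ga)
  also have "\<dots> \<oplus> ?g (Suc n) 0 = a \<otimes> ?G \<oplus> ((\<Oplus>k\<in>{..n}. ?v (Suc k)) \<oplus> ?v 0)"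
    using a b G by (subst a_assoc) auto
  also have "\<dots> = (a \<oplus> b) \<otimes> ?G"
    unfolding v using a b G by (simp add: l_distr)
  finally show ?case using a b G by (simp add: Suc.IH m_comm)
qed

lemma (in cring) characteristic_add_pow:
  assumes "has_characteristic R p" "p dvd n" "x \<in> carrier R"
  shows "[n] \<cdot> x = \<zero>"
proof -
  have "[n] \<cdot> \<one> = \<zero>" using assms unfolding has_characteristic_def by blast
  then show ?thesis using add_pow_ldistr[of \<one> x n] assms(3) by simp
qed

lemma (in cring) frobenius_add:
  assumes p: "Factorial_Ring.prime p" and char: "has_characteristic R p"
    and ab: "a \<in> carrier R" "b \<in> carrier R"
  shows "(a \<oplus> b) [^] p = a [^] p \<oplus> b [^] p"
proof -
  obtain q where q: "p = Suc (Suc q)"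
    using prime_ge_2_nat[OF p] by (metis add_2_eq_Suc le_Suc_ex)
  let ?g = "\<lambda>k. [(p choose k)] \<cdot> (a [^] k \<otimes> b [^] (p - k))"
  have mid: "(\<Oplus>k\<in>{..q}. ?g (Suc k)) = \<zero>"
  proof (rule add.finprod_one_eqI)
    fix k assume "k \<in> {..q}"
    then have "p dvd (p choose Suc k)"
      using p q by (intro dvd_choose_prime) auto
    then show "?g (Suc k) = \<zero>"
      using ab by (intro characteristic_add_pow[OF char]) auto
  qed
  have g: "?g \<in> A \<rightarrow> carrier R" for A using ab by auto
  have "(a \<oplus> b) [^] p = finsum R ?g {..Suc (Suc q)}"
    using binomial[OF ab, of p] q by simp
  also have "\<dots> = ?g p \<oplus> finsum R ?g {..Suc q}"
    using g[of "{..Suc (Suc q)}"] by (simp only: finsum_Suc q)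
  also have "finsum R ?g {..Suc q} = \<zero> \<oplus> ?g 0"
    using g[of "{..Suc q}"] by (simp only: finsum_Suc2 mid)
  finally show ?thesis using ab by simp
qed

lemma (in cring) frobenius_power_add:
  assumes p: "Factorial_Ring.prime p" and char: "has_characteristic R p"
    and ab: "a \<in> carrier R" "b \<in> carrier R"
  shows "(a \<oplus> b) [^] (p ^ e) = a [^] (p ^ e) \<oplus> b [^] (p ^ e)"
proof (induction e)
  case (Suc e)
  have step: "x [^] (p ^ Suc e) = (x [^] (p ^ e)) [^] p" if "x \<in> carrier R" for x
    using that by (simp add: nat_pow_pow mult.commute)
  show ?case using ab by (simp only: step a_closed Suc.IH frobenius_add[OF p char] nat_pow_closed)
qed (use ab in simp)

lemma frobenius_module_simps [simp]:
  "carrier (frobenius_module p e R) = carrier R"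
  "add (frobenius_module p e R) = add R"
  "ring.zero (frobenius_module p e R) = ring.zero R"
  "smult (frobenius_module p e R) = (\<lambda>r x. (r [^]\<^bsub>R\<^esub> (p ^ e)) \<otimes>\<^bsub>R\<^esub> x)"
  by (simp_all add: frobenius_module_def)

lemma regular_module_simps [simp]:
  "carrier (regular_module R) = carrier R"
  "add (regular_module R) = add R"
  "ring.zero (regular_module R) = ring.zero R"
  "smult (regular_module R) = monoid.mult R"
  by (simp_all add: regular_module_def)

lemma (in cring) module_frobenius_module:
  assumes p: "Factorial_Ring.prime p" and char: "has_characteristic R p"
  shows "module R (frobenius_module p e R)"
proof (rule moduleI)
  show "cring R" by (rule is_cring)
  show "abelian_group (frobenius_module p e R)"
    by (rule abelian_groupI) (auto simp: a_ac intro: l_neg)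
qed (auto simp: frobenius_power_add[OF p char] l_distr r_distr nat_pow_distrib m_ac)

section \<open>Vanishing of pure tensors\<close>

lemma diff_closed_free_Abelian_group:
  assumes "u \<in> carrier (free_Abelian_group A)" "v \<in> carrier (free_Abelian_group A)"
  shows "u - v \<in> carrier (free_Abelian_group A)"
  using assms keys_diff[of u v] by (simp add: subset_iff) blast

lemma (in comm_group) hom_vanishes_on_generate:
  assumes h: "h \<in> hom G H" and H: "group H"
    and T: "T \<subseteq> carrier G" "\<And>t. t \<in> T \<Longrightarrow> h t = \<one>\<^bsub>H\<^esub>" and x: "x \<in> generate G T"
  shows "h x = \<one>\<^bsub>H\<^esub>"
proof -
  interpret h: group_hom G H h
    using h H is_group by (simp add: group_hom_def group_hom_axioms_def)
  have "subgroup (kernel G H h) G" by (rule h.subgroup_kernel)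
  moreover have "T \<subseteq> kernel G H h" using T unfolding kernel_def by blast
  ultimately have "generate G T \<subseteq> kernel G H h" by (rule generate_subgroup_incl[rotated])
  then show ?thesis using x unfolding kernel_def by blast
qed

lemma tensor_relationsI:
  "\<lbrakk>x \<in> carrier N; y \<in> carrier N; z \<in> carrier M\<rbrakk> \<Longrightarrow>
    frag_of (x \<oplus>\<^bsub>N\<^esub> y, z) - frag_of (x, z) - frag_of (y, z) \<in> tensor_relations R N M"
  "\<lbrakk>x \<in> carrier N; z \<in> carrier M; w \<in> carrier M\<rbrakk> \<Longrightarrow>
    frag_of (x, z \<oplus>\<^bsub>M\<^esub> w) - frag_of (x, z) - frag_of (x, w) \<in> tensor_relations R N M"
  "\<lbrakk>r \<in> carrier R; x \<in> carrier N; z \<in> carrier M\<rbrakk> \<Longrightarrow>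
    frag_of (r \<odot>\<^bsub>N\<^esub> x, z) - frag_of (x, r \<odot>\<^bsub>M\<^esub> z) \<in> tensor_relations R N M"
  unfolding tensor_relations_def by blast+

lemma tensor_relations_closed:
  assumes "module R N" "module R M"
  shows "tensor_relations R N M \<subseteq> carrier (free_Abelian_group (carrier N \<times> carrier M))"
proof -
  interpret N: module R N by fact
  interpret M: module R M by fact
  show ?thesis
    unfolding tensor_relations_def
    by (intro Un_least subsetI)
      (elim CollectE exE conjE; hypsubst; intro diff_closed_free_Abelian_group; simp)+
qed

lemma pure_tensor_eq_one_iff:
  assumes "module R N" "module R M" and "x \<in> carrier N" "z \<in> carrier M"
  shows "pure_tensor R N M x z = \<one>\<^bsub>tensor_product R N M\<^esub> \<longleftrightarrow>
    frag_of (x, z) \<in> generate (free_Abelian_group (carrier N \<times> carrier M)) (tensor_relations R N M)"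
    (is "_ \<longleftrightarrow> _ \<in> ?H")
proof -
  let ?F = "free_Abelian_group (carrier N \<times> carrier M)"
  interpret F: comm_group ?F by (rule abelian_free_Abelian_group)
  have H: "subgroup ?H ?F"
    by (rule F.generate_is_subgroup[OF tensor_relations_closed[OF assms(1,2)]])
  have "?H #>\<^bsub>?F\<^esub> frag_of (x, z) = ?H \<longleftrightarrow> frag_of (x, z) \<in> ?H"
    using F.coset_join1[OF _ _ H] F.coset_join2[OF _ H] subgroup.subset[OF H] assms(3,4) by auto
  then show ?thesis
    by (simp add: pure_tensor_def tensor_product_def Let_def FactGroup_def)
qed

text \<open>Tensoring \<open>\<psi>\<close> with \<open>M\<close> gives the map \<open>N \<otimes> M \<rightarrow> M\<close>, \<open>n \<otimes> m \<mapsto> \<psi>(n) m\<close>. It is built on the free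
  abelian group, where it kills the defining relations of the tensor product.\<close>

lemma linear_map_tensor_vanishes:
  assumes N: "module R N" and M: "module R M" and \<psi>: "\<psi> \<in> linear_maps R N (regular_module R)"
    and x: "x \<in> carrier N" and z: "z \<in> carrier M"
    and zero: "pure_tensor R N M x z = \<one>\<^bsub>tensor_product R N M\<^esub>"
  shows "\<psi> x \<odot>\<^bsub>M\<^esub> z = \<zero>\<^bsub>M\<^esub>"
proof -
  let ?F = "free_Abelian_group (carrier N \<times> carrier M)"
  interpret N: module R N by fact
  interpret M: module R M by fact
  interpret F: comm_group ?F by (rule abelian_free_Abelian_group)
  have \<psi>_closed: "\<And>n. n \<in> carrier N \<Longrightarrow> \<psi> n \<in> carrier R"
    and \<psi>_add: "\<And>n n'. \<lbrakk>n \<in> carrier N; n' \<in> carrier N\<rbrakk> \<Longrightarrow> \<psi> (n \<oplus>\<^bsub>N\<^esub> n') = \<psi> n \<oplus>\<^bsub>R\<^esub> \<psi> n'"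
    and \<psi>_smult: "\<And>r n. \<lbrakk>r \<in> carrier R; n \<in> carrier N\<rbrakk> \<Longrightarrow> \<psi> (r \<odot>\<^bsub>N\<^esub> n) = r \<otimes>\<^bsub>R\<^esub> \<psi> n"
    using \<psi> unfolding linear_maps_def by auto
  have "(\<lambda>(n, m). \<psi> n \<odot>\<^bsub>M\<^esub> m) ` (carrier N \<times> carrier M) \<subseteq> carrier (add_monoid M)"
    using \<psi>_closed by auto
  from comm_group.free_Abelian_group_universal[OF M.a_comm_group this]
  obtain h where h: "h \<in> hom ?F (add_monoid M)"
    and h_of: "\<And>u. u \<in> carrier N \<times> carrier M \<Longrightarrow> h (frag_of u) = (case u of (n, m) \<Rightarrow> \<psi> n \<odot>\<^bsub>M\<^esub> m)"
    by blast
  interpret h: group_hom ?F "add_monoid M" h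
    using h F.is_group M.a_group by (simp add: group_hom_def group_hom_axioms_def)
  have h_diff: "h (u - v) = h u \<ominus>\<^bsub>M\<^esub> h v" if "u \<in> carrier ?F" "v \<in> carrier ?F" for u v
  proof -
    have "h (u - v) = h (u \<otimes>\<^bsub>?F\<^esub> inv\<^bsub>?F\<^esub> v)" using that by simp
    also have "\<dots> = h u \<ominus>\<^bsub>M\<^esub> h v"
      using that h.hom_mult[of u "inv\<^bsub>?F\<^esub> v"] h.hom_inv[of v] F.inv_closed[of v]
      by (simp add: a_minus_def a_inv_def)
    finally show ?thesis .
  qed
  have vanish: "h t = \<zero>\<^bsub>M\<^esub>" if t: "t \<in> tensor_relations R N M" for t
  proof -
    note diff = diff_closed_free_Abelian_group
    consider (left) n n' m where "t = frag_of (n \<oplus>\<^bsub>N\<^esub> n', m) - frag_of (n, m) - frag_of (n', m)"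
        "n \<in> carrier N" "n' \<in> carrier N" "m \<in> carrier M"
      | (right) n m m' where "t = frag_of (n, m \<oplus>\<^bsub>M\<^esub> m') - frag_of (n, m) - frag_of (n, m')"
        "n \<in> carrier N" "m \<in> carrier M" "m' \<in> carrier M"
      | (scal) r n m where "t = frag_of (r \<odot>\<^bsub>N\<^esub> n, m) - frag_of (n, r \<odot>\<^bsub>M\<^esub> m)"
        "r \<in> carrier R" "n \<in> carrier N" "m \<in> carrier M"
      using t unfolding tensor_relations_def by blast
    then show ?thesis
    proof cases
      case left
      then have "h t = (\<psi> n \<odot>\<^bsub>M\<^esub> m \<oplus>\<^bsub>M\<^esub> \<psi> n' \<odot>\<^bsub>M\<^esub> m) \<ominus>\<^bsub>M\<^esub> \<psi> n \<odot>\<^bsub>M\<^esub> m \<ominus>\<^bsub>M\<^esub> \<psi> n' \<odot>\<^bsub>M\<^esub> m"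
        by (simp add: h_diff diff h_of \<psi>_add \<psi>_closed M.smult_l_distr del: carrier_free_Abelian_group_iff)
      then show ?thesis using left \<psi>_closed
        by (simp add: M.minus_eq M.a_ac M.r_neg M.r_neg1 M.r_neg2)
    next
      case right
      then have "h t = (\<psi> n \<odot>\<^bsub>M\<^esub> m \<oplus>\<^bsub>M\<^esub> \<psi> n \<odot>\<^bsub>M\<^esub> m') \<ominus>\<^bsub>M\<^esub> \<psi> n \<odot>\<^bsub>M\<^esub> m \<ominus>\<^bsub>M\<^esub> \<psi> n \<odot>\<^bsub>M\<^esub> m'"
        by (simp add: h_diff diff h_of \<psi>_closed M.smult_r_distr del: carrier_free_Abelian_group_iff)
      then show ?thesis using right \<psi>_closed
        by (simp add: M.minus_eq M.a_ac M.r_neg M.r_neg1 M.r_neg2)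
    next
      case scal
      then have "h t = (r \<otimes>\<^bsub>R\<^esub> \<psi> n) \<odot>\<^bsub>M\<^esub> m \<ominus>\<^bsub>M\<^esub> \<psi> n \<odot>\<^bsub>M\<^esub> (r \<odot>\<^bsub>M\<^esub> m)"
        by (simp add: h_diff h_of \<psi>_closed \<psi>_smult del: carrier_free_Abelian_group_iff)
      also have "\<psi> n \<odot>\<^bsub>M\<^esub> (r \<odot>\<^bsub>M\<^esub> m) = (r \<otimes>\<^bsub>R\<^esub> \<psi> n) \<odot>\<^bsub>M\<^esub> m"
        using scal \<psi>_closed by (simp add: M.smult_assoc1[symmetric] N.m_comm)
      finally show ?thesis using scal \<psi>_closed by (simp add: M.minus_eq M.r_neg)
    qed
  qed
  have "h (frag_of (x, z)) = \<one>\<^bsub>add_monoid M\<^esub>"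
  proof (rule F.hom_vanishes_on_generate[OF h M.a_group])
    show "tensor_relations R N M \<subseteq> carrier ?F" by (rule tensor_relations_closed[OF N M])
    show "h t = \<one>\<^bsub>add_monoid M\<^esub>" if "t \<in> tensor_relations R N M" for t
      using vanish[OF that] by simp
    show "frag_of (x, z) \<in> generate ?F (tensor_relations R N M)"
      by (rule iffD1[OF pure_tensor_eq_one_iff[OF N M x z] zero])
  qed
  then show ?thesis using h_of x z by simp
qed

section \<open>Cyclic modules and tight closure of ideals\<close>

text \<open>A copy of \<open>R/I\<close> on a prescribed type: \<open>\<pi>\<close> maps \<open>x\<close> to the element that stands for \<open>x + I\<close>, and
  the operations choose representatives through \<open>inv_into\<close>. The multiplication and the one are
  dummies, since the record type of modules extends that of rings.\<close>

definition cyclic_module :: "('a, 'r) ring_scheme \<Rightarrow> ('a \<Rightarrow> 'u) \<Rightarrow> ('a, 'u) module" where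
  "cyclic_module R \<pi> =
     (let rep = inv_into (carrier R) \<pi> in
      \<lparr>carrier = \<pi> ` carrier R, monoid.mult = (\<lambda>u v. u), one = \<pi> \<one>\<^bsub>R\<^esub>,
       ring.zero = \<pi> \<zero>\<^bsub>R\<^esub>, add = (\<lambda>u v. \<pi> (rep u \<oplus>\<^bsub>R\<^esub> rep v)),
       smult = (\<lambda>r u. \<pi> (r \<otimes>\<^bsub>R\<^esub> rep u))\<rparr>)"

locale quotient_by_ideal = cring R + ideal I R for R (structure) and I +
  fixes \<pi> :: "'a \<Rightarrow> 'u"
  assumes \<pi>_eq_iff: "\<lbrakk>x \<in> carrier R; y \<in> carrier R\<rbrakk> \<Longrightarrow> \<pi> x = \<pi> y \<longleftrightarrow> x \<ominus> y \<in> I"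
begin

lemma \<pi>_rep:
  assumes "x \<in> carrier R"
  shows "inv_into (carrier R) \<pi> (\<pi> x) \<in> carrier R" and "inv_into (carrier R) \<pi> (\<pi> x) \<ominus> x \<in> I"
proof -
  have "\<pi> x \<in> \<pi> ` carrier R" using assms by blast
  from inv_into_into[OF this] f_inv_into_f[OF this]
  show "inv_into (carrier R) \<pi> (\<pi> x) \<in> carrier R" and "inv_into (carrier R) \<pi> (\<pi> x) \<ominus> x \<in> I"
    using assms \<pi>_eq_iff by auto
qed

lemma cyclic_module_simps:
  "carrier (cyclic_module R \<pi>) = \<pi> ` carrier R"
  "\<zero>\<^bsub>cyclic_module R \<pi>\<^esub> = \<pi> \<zero>"
  by (simp_all add: cyclic_module_def Let_def)

lemma cyclic_module_add:
  assumes x: "x \<in> carrier R" and y: "y \<in> carrier R"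
  shows "\<pi> x \<oplus>\<^bsub>cyclic_module R \<pi>\<^esub> \<pi> y = \<pi> (x \<oplus> y)"
proof -
  define a b where "a = inv_into (carrier R) \<pi> (\<pi> x)" and "b = inv_into (carrier R) \<pi> (\<pi> y)"
  have ab: "a \<in> carrier R" "b \<in> carrier R" "a \<ominus> x \<in> I" "b \<ominus> y \<in> I"
    unfolding a_def b_def using \<pi>_rep x y by auto
  have "(a \<oplus> b) \<ominus> (x \<oplus> y) = (a \<ominus> x) \<oplus> (b \<ominus> y)"
    using ab(1,2) x y by (simp add: minus_eq minus_add a_ac)
  then have "(a \<oplus> b) \<ominus> (x \<oplus> y) \<in> I" using ab(3,4) by simp
  then show ?thesis
    using \<pi>_eq_iff[of "a \<oplus> b" "x \<oplus> y"] ab(1,2) x y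
    by (simp add: cyclic_module_def Let_def a_def b_def)
qed

lemma cyclic_module_smult:
  assumes r: "r \<in> carrier R" and x: "x \<in> carrier R"
  shows "r \<odot>\<^bsub>cyclic_module R \<pi>\<^esub> \<pi> x = \<pi> (r \<otimes> x)"
proof -
  define a where "a = inv_into (carrier R) \<pi> (\<pi> x)"
  have a: "a \<in> carrier R" "a \<ominus> x \<in> I"
    unfolding a_def using \<pi>_rep x by auto
  have "(r \<otimes> a) \<ominus> (r \<otimes> x) = r \<otimes> (a \<ominus> x)"
    using a(1) x r by (simp add: minus_eq r_distr r_minus)
  then have "(r \<otimes> a) \<ominus> (r \<otimes> x) \<in> I" using a(2) r I_l_closed by simp
  then show ?thesis
    using \<pi>_eq_iff[of "r \<otimes> a" "r \<otimes> x"] a(1) x r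
    by (simp add: cyclic_module_def Let_def a_def)
qed

lemma module_cyclic_module: "module R (cyclic_module R \<pi>)"
proof (rule moduleI)
  show "cring R" by (rule is_cring)
  have neg: "\<exists>y\<in>carrier R. \<pi> (x \<oplus> y) = \<pi> \<zero>" if "x \<in> carrier R" for x
    using that by (intro bexI[of _ "\<ominus> x"]) (simp_all add: r_neg)
  show "abelian_group (cyclic_module R \<pi>)"
    by (rule abelian_groupI) (auto simp: cyclic_module_simps cyclic_module_add a_ac neg)
qed (auto simp: cyclic_module_simps cyclic_module_add cyclic_module_smult l_distr r_distr m_assoc)

text \<open>For \<open>i \<in> I\<close> and \<open>q = p\<^sup>e\<close> the relation \<open>t i\<^sup>q \<otimes> 1 = t \<otimes> i 1 = 0\<close> holds in \<open>\<^sup>eR \<otimes> R/I\<close> for every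
  \<open>t\<close>, and multiples of the \<open>i\<^sup>q\<close> span the Frobenius power of \<open>I\<close>.\<close>

lemma tensor_with_cyclic_module_vanishes:
  assumes N: "module R (frobenius_module p e R)"
    and w: "w \<in> frobenius_power R I (p ^ e)"
  shows "frag_of (w, \<pi> \<one>) \<in> generate (free_Abelian_group (carrier R \<times> \<pi> ` carrier R))
     (tensor_relations R (frobenius_module p e R) (cyclic_module R \<pi>))"
    (is "_ \<in> ?H")
proof -
  let ?F = "free_Abelian_group (carrier R \<times> \<pi> ` carrier R)"
  let ?N = "frobenius_module p e R" and ?M = "cyclic_module R \<pi>"
  let ?q = "p ^ e"
  interpret F: comm_group ?F by (rule abelian_free_Abelian_group)
  have H: "subgroup ?H ?F"
    using tensor_relations_closed[OF N module_cyclic_module]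
    by (intro F.generate_is_subgroup) (simp add: cyclic_module_simps)
  have H_add: "u + v \<in> ?H" if "u \<in> ?H" "v \<in> ?H" for u v
    using subgroup.m_closed[OF H that] by simp
  have H_neg: "- u \<in> ?H" if "u \<in> ?H" for u
    using subgroup.m_inv_closed[OF H that] subgroup.mem_carrier[OF H that] by simp
  have left: "frag_of (x \<oplus> y, z) - frag_of (x, z) - frag_of (y, z) \<in> ?H"
    if "x \<in> carrier R" "y \<in> carrier R" "z \<in> \<pi> ` carrier R" for x y z
    using that tensor_relationsI(1)[where R = R and N = ?N and M = ?M]
    by (intro generate.incl) (simp add: cyclic_module_simps)
  have right: "frag_of (x, \<pi> y \<oplus>\<^bsub>?M\<^esub> \<pi> z) - frag_of (x, \<pi> y) - frag_of (x, \<pi> z) \<in> ?H"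
    if "x \<in> carrier R" "y \<in> carrier R" "z \<in> carrier R" for x y z
    using that tensor_relationsI(2)[where R = R and N = ?N and M = ?M]
    by (intro generate.incl) (simp add: cyclic_module_simps)
  have bal: "frag_of (r [^] ?q \<otimes> x, \<pi> y) - frag_of (x, r \<odot>\<^bsub>?M\<^esub> \<pi> y) \<in> ?H"
    if "r \<in> carrier R" "x \<in> carrier R" "y \<in> carrier R" for r x y
    using that tensor_relationsI(3)[where R = R and N = ?N and M = ?M]
    by (intro generate.incl) (simp add: cyclic_module_simps)
  have z: "\<zero> \<in> carrier R" by simp
  have zero_right: "frag_of (x, \<pi> \<zero>) \<in> ?H" if "x \<in> carrier R" for x
    using H_neg[OF right[OF that z z]] by (simp add: cyclic_module_add)
  have zero_left: "frag_of (\<zero>, \<pi> \<one>) \<in> ?H"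
    using H_neg[OF left[OF z z, of "\<pi> \<one>"]] by simp
  \<comment> \<open>Quantifying over the multipliers \<open>t\<close> makes this set an ideal, as \<open>?H\<close> is only a subgroup.\<close>
  define D where "D = {w \<in> carrier R. \<forall>t\<in>carrier R. frag_of (t \<otimes> w, \<pi> \<one>) \<in> ?H}"
  have addD: "x \<oplus> y \<in> D" if "x \<in> D" "y \<in> D" for x y
  proof -
    have xy: "x \<in> carrier R" "y \<in> carrier R" using that unfolding D_def by auto
    have "frag_of (t \<otimes> (x \<oplus> y), \<pi> \<one>) \<in> ?H" if t: "t \<in> carrier R" for t
    proof -
      have "frag_of (t \<otimes> x, \<pi> \<one>) \<in> ?H" "frag_of (t \<otimes> y, \<pi> \<one>) \<in> ?H"
        using \<open>x \<in> D\<close> \<open>y \<in> D\<close> t unfolding D_def by auto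
      from H_add[OF H_add[OF left[of "t \<otimes> x" "t \<otimes> y" "\<pi> \<one>"] this(1)] this(2)]
      show ?thesis using t xy by (simp add: r_distr)
    qed
    then show ?thesis using xy unfolding D_def by simp
  qed
  have multD: "r \<otimes> x \<in> D" if "x \<in> D" "r \<in> carrier R" for r x
    using that unfolding D_def by (simp add: m_assoc[symmetric])
  have "ideal D R"
    by (rule ideal_of_closed[OF _ _ addD multD]) (auto simp: D_def zero_left)
  moreover have "(\<lambda>x. x [^] ?q) ` I \<subseteq> D"
  proof
    fix w assume "w \<in> (\<lambda>x. x [^] ?q) ` I"
    then obtain i where i: "i \<in> I" "w = i [^] ?q" by blast
    then have ic: "i \<in> carrier R" using Icarr by blast
    have \<pi>i: "\<pi> i = \<pi> \<zero>" using \<pi>_eq_iff[of i \<zero>] i ic by (simp add: minus_eq)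
    have "frag_of (t \<otimes> w, \<pi> \<one>) \<in> ?H" if t: "t \<in> carrier R" for t
      using H_add[OF bal[OF ic t one_closed] zero_right[OF t]] ic t
      by (simp add: i(2) cyclic_module_smult \<pi>i m_comm)
    then show "w \<in> D" using i(2) ic unfolding D_def by simp
  qed
  ultimately have "frobenius_power R I ?q \<subseteq> D"
    unfolding frobenius_power_def by (rule genideal_minimal)
  then have "w \<in> D" using w by blast
  then have "frag_of (\<one> \<otimes> w, \<pi> \<one>) \<in> ?H" "w \<in> carrier R" unfolding D_def by blast+
  then show ?thesis by simp
qed

end

text \<open>If \<open>x\<close> is in the tight closure of \<open>I\<close>, then its class is in the tight closure of zero in \<open>R/I\<close>,
  because \<open>c \<otimes> x = c x\<^sup>q \<otimes> 1 = 0\<close>; an element that kills the class maps \<open>x\<close> into \<open>I\<close>. Cosets are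
  subsets of \<open>R\<close>, so \<open>R/I\<close> has a copy on any type into which the subsets embed.\<close>

lemma (in cring) big_test_ideal_subset_finitistic_test_ideal:
  assumes p: "Factorial_Ring.prime p" and char: "has_characteristic R p"
    and f: "inj (f :: 'a set \<Rightarrow> 'u)"
  shows "big_test_ideal p R TYPE('u) \<subseteq> finitistic_test_ideal p R"
proof
  fix r assume r: "r \<in> big_test_ideal p R TYPE('u)"
  then have rc: "r \<in> carrier R"
    and kill: "\<And>(M :: ('a, 'u) module) z. \<lbrakk>module R M; z \<in> zero_tight_closure p R M\<rbrakk> \<Longrightarrow> r \<odot>\<^bsub>M\<^esub> z = \<zero>\<^bsub>M\<^esub>"
    unfolding big_test_ideal_def by blast+
  have "r \<otimes> x \<in> I" if I: "ideal I R" and x: "x \<in> tight_closure p R I" for I x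
  proof -
    interpret quotient_by_ideal R I "\<lambda>x. f (I +> x)"
    proof (intro quotient_by_ideal.intro quotient_by_ideal_axioms.intro is_cring I)
      fix x y assume "x \<in> carrier R" "y \<in> carrier R"
      then show "f (I +> x) = f (I +> y) \<longleftrightarrow> x \<ominus> y \<in> I"
        by (simp add: quotient_eq_iff_same_a_r_cos[OF I] inj_eq[OF f])
    qed
    let ?\<pi> = "\<lambda>x. f (I +> x)"
    let ?M = "cyclic_module R ?\<pi>"
    note M = module_cyclic_module
    obtain c where xc: "x \<in> carrier R" and c: "c \<in> off_minimal_primes R"
      and ev: "\<forall>\<^sub>F e in sequentially. c \<otimes> x [^] (p ^ e) \<in> frobenius_power R I (p ^ e)"
      using x unfolding tight_closure_def by blast
    have cc: "c \<in> carrier R" using c unfolding off_minimal_primes_def by blast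
    have "\<forall>\<^sub>F e in sequentially. pure_tensor R (frobenius_module p e R) ?M c (?\<pi> x) =
        \<one>\<^bsub>tensor_product R (frobenius_module p e R) ?M\<^esub>"
      using ev
    proof (rule eventually_mono)
      fix e assume e: "c \<otimes> x [^] (p ^ e) \<in> frobenius_power R I (p ^ e)"
      let ?N = "frobenius_module p e R"
      let ?F = "free_Abelian_group (carrier ?N \<times> carrier ?M)"
      let ?H = "generate ?F (tensor_relations R ?N ?M)"
      note N = module_frobenius_module[OF p char, of e]
      interpret F: comm_group ?F by (rule abelian_free_Abelian_group)
      have H: "subgroup ?H ?F"
        by (rule F.generate_is_subgroup[OF tensor_relations_closed[OF N M]])
      have u: "frag_of (x [^] (p ^ e) \<otimes> c, ?\<pi> \<one>) \<in> ?H"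
        using tensor_with_cyclic_module_vanishes[OF N e] cc xc
        by (simp add: cyclic_module_simps m_comm)
      have v: "frag_of (x [^] (p ^ e) \<otimes> c, ?\<pi> \<one>) - frag_of (c, ?\<pi> x) \<in> ?H"
        using xc cc cyclic_module_smult[OF xc one_closed]
          tensor_relationsI(3)[where R = R and N = ?N and M = ?M and r = x and x = c and z = "?\<pi> \<one>"]
        by (intro generate.incl) (simp add: cyclic_module_simps)
      have "u - v \<in> ?H" if "u \<in> ?H" "v \<in> ?H" for u v
        using subgroup.m_closed[OF H that(1) subgroup.m_inv_closed[OF H that(2)]]
          subgroup.mem_carrier[OF H that(2)] by simp
      from this[OF u v] have "frag_of (c, ?\<pi> x) \<in> ?H" by simp
      then show "pure_tensor R ?N ?M c (?\<pi> x) = \<one>\<^bsub>tensor_product R ?N ?M\<^esub>"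
        by (intro iffD2[OF pure_tensor_eq_one_iff[OF N M]])
          (simp_all add: cc xc cyclic_module_simps)
    qed
    then have "?\<pi> x \<in> zero_tight_closure p R ?M"
      unfolding zero_tight_closure_def using c xc
      by (intro CollectI conjI bexI) (simp_all add: cyclic_module_simps)
    from kill[OF M this] have "?\<pi> (r \<otimes> x) = ?\<pi> \<zero>"
      using cyclic_module_smult[OF rc xc] by (simp add: cyclic_module_simps)
    then show ?thesis using \<pi>_eq_iff[of "r \<otimes> x" \<zero>] rc xc by (simp add: minus_eq)
  qed
  then show "r \<in> finitistic_test_ideal p R"
    unfolding finitistic_test_ideal_def ideal_colon_def using rc by blast
qed

section \<open>Noetherian rings in which every nonzerodivisor is a unit\<close>

lemma (in noetherian_ring) maximal_ideal_in_family:
  assumes "F \<noteq> {}" "\<And>J. J \<in> F \<Longrightarrow> ideal J R"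
  obtains M where "M \<in> F" "\<And>J. \<lbrakk>J \<in> F; M \<subseteq> J\<rbrakk> \<Longrightarrow> J = M"
proof -
  have "\<exists>M\<in>F. \<forall>J\<in>F. M \<subseteq> J \<longrightarrow> J = M"
  proof (rule subset_Zorn_nonempty[OF assms(1)])
    fix C assume ne: "C \<noteq> {}" and C: "subset.chain F C"
    from C have CF: "C \<subseteq> F" unfolding subset.chain_def by (rule conjunct1)
    then have "C \<subseteq> {I. ideal I R}" by (intro subsetI CollectI assms(2) subsetD[OF CF])
    then have "subset.chain {I. ideal I R} C"
      using C unfolding subset.chain_def by simp
    then have "\<Union>C \<in> C" by (rule ideal_chain_is_trivial[OF ne])
    then show "\<Union>C \<in> F" by (rule subsetD[OF CF])
  qed
  then obtain M where "M \<in> F" "\<forall>J\<in>F. M \<subseteq> J \<longrightarrow> J = M" by (rule bexE)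
  then show thesis by (intro that[of M]) simp_all
qed

lemma reduced_ring_square:
  fixes R (structure)
  assumes "reduced_ring R" "cring R" "x \<in> carrier R" "x \<otimes>\<^bsub>R\<^esub> x = \<zero>\<^bsub>R\<^esub>"
  shows "x = \<zero>\<^bsub>R\<^esub>"
proof -
  interpret cring R by fact
  have "x [^] (2::nat) = \<zero>" using assms(3,4) by (simp add: numeral_2_eq_2)
  then show ?thesis using assms unfolding reduced_ring_def by blast
qed

lemma reduced_ring_square_mult:
  fixes R (structure)
  assumes "reduced_ring R" "cring R" "x \<in> carrier R" "y \<in> carrier R" "x \<otimes>\<^bsub>R\<^esub> (x \<otimes>\<^bsub>R\<^esub> y) = \<zero>\<^bsub>R\<^esub>"
  shows "x \<otimes>\<^bsub>R\<^esub> y = \<zero>\<^bsub>R\<^esub>"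
proof (rule reduced_ring_square[OF assms(1,2)])
  interpret cring R by fact
  have "(x \<otimes> y) \<otimes> (x \<otimes> y) = y \<otimes> (x \<otimes> (x \<otimes> y))" using assms(3,4) by (simp add: m_ac)
  then show "(x \<otimes> y) \<otimes> (x \<otimes> y) = \<zero>" using assms(4,5) by simp
  show "x \<otimes> y \<in> carrier R" using assms(3,4) by simp
qed

text \<open>Choose \<open>t \<in> J\<close> with the largest double annihilator. If \<open>t u = 0\<close> for some \<open>u \<in> J\<close>, then, the ring
  being reduced, \<open>Ann(t + u) = Ann(t) \<inter> Ann(u)\<close>; so \<open>t + u\<close> has a double annihilator that contains
  the old one and also \<open>u\<close>. Maximality puts \<open>u\<close> into the double annihilator of \<open>t\<close>, whence
  \<open>u\<^sup>2 = 0\<close> and \<open>u = 0\<close>.\<close>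

lemma faithful_element_of_ideal:
  fixes R (structure)
  assumes R: "cring R" "noetherian_ring R" "reduced_ring R" and J: "ideal J R"
  shows "\<exists>t\<in>J. \<forall>u\<in>J. t \<otimes>\<^bsub>R\<^esub> u = \<zero>\<^bsub>R\<^esub> \<longrightarrow> u = \<zero>\<^bsub>R\<^esub>"
proof -
  interpret cring R by fact
  interpret N: noetherian_ring R by fact
  interpret J: ideal J R by fact
  \<comment> \<open>\<open>bi t\<close> is the double annihilator \<open>Ann(Ann(t))\<close>.\<close>
  define bi where "bi t = {x \<in> carrier R. \<forall>v\<in>carrier R. t \<otimes> v = \<zero> \<longrightarrow> x \<otimes> v = \<zero>}" for t
  have ideal_bi: "ideal (bi t) R" for t
    by (rule ideal_of_closed) (auto simp: bi_def l_distr m_assoc)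
  have "bi ` J \<noteq> {}" using J.zero_closed by blast
  then obtain M where "M \<in> bi ` J" and max: "\<And>I. \<lbrakk>I \<in> bi ` J; M \<subseteq> I\<rbrakk> \<Longrightarrow> I = M"
    by (rule N.maximal_ideal_in_family) (use ideal_bi in blast)+
  then obtain t where t: "t \<in> J" "M = bi t" by blast
  have tc: "t \<in> carrier R" using t J.Icarr by blast
  have "u = \<zero>" if u: "u \<in> J" and tu: "t \<otimes> u = \<zero>" for u
  proof -
    have uc: "u \<in> carrier R" using u J.Icarr by blast
    have ann: "t \<otimes> v = \<zero> \<and> u \<otimes> v = \<zero>" if v: "v \<in> carrier R" and z: "(t \<oplus> u) \<otimes> v = \<zero>" for v
    proof -
      have "t \<otimes> (t \<otimes> v) = t \<otimes> ((t \<oplus> u) \<otimes> v) \<ominus> (t \<otimes> u) \<otimes> v"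
        using tc uc v by algebra
      also have "\<dots> = \<zero>" using z tu tc v by (simp add: minus_eq)
      finally have "t \<otimes> v = \<zero>" by (rule reduced_ring_square_mult[OF R(3,1) tc v])
      with z show ?thesis using tc uc v by (simp add: l_distr)
    qed
    have "bi (t \<oplus> u) \<in> bi ` J" using t u by simp
    moreover have "bi t \<subseteq> bi (t \<oplus> u)" using ann unfolding bi_def by auto
    ultimately have "bi (t \<oplus> u) = bi t" using max t(2) by blast
    moreover have "u \<in> bi (t \<oplus> u)" using ann uc unfolding bi_def by auto
    ultimately have "u \<otimes> u = \<zero>" using tu uc unfolding bi_def by auto
    then show ?thesis by (rule reduced_ring_square[OF R(3,1) uc])
  qed
  then show ?thesis using t(1) by blast
qed

text \<open>Such a ring is a finite product of fields, so every ideal is generated by an idempotent. The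
  idempotent is found directly: for faithful elements \<open>t\<close> of \<open>J\<close> and \<open>s\<close> of \<open>Ann(t)\<close>, the sum
  \<open>t + s\<close> is a nonzerodivisor, hence a unit, and \<open>J s = 0\<close>; so \<open>t/(t + s)\<close> acts on \<open>J\<close> as the
  identity.\<close>

lemma ideal_has_identity:
  fixes R (structure)
  assumes R: "cring R" "noetherian_ring R" "reduced_ring R"
    and units: "nonzerodivisors R \<subseteq> Units R" and J: "ideal J R"
  shows "\<exists>\<epsilon>\<in>J. \<forall>x\<in>J. x \<otimes>\<^bsub>R\<^esub> \<epsilon> = x"
proof -
  interpret cring R by fact
  interpret J: ideal J R by fact
  obtain t where t: "t \<in> J" "\<And>u. \<lbrakk>u \<in> J; t \<otimes> u = \<zero>\<rbrakk> \<Longrightarrow> u = \<zero>"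
    using faithful_element_of_ideal[OF R J] by blast
  have tc: "t \<in> carrier R" using t(1) J.Icarr by blast
  let ?A = "{u \<in> carrier R. t \<otimes> u = \<zero>}"
  have "ideal ?A R"
    by (rule ideal_of_closed) (use tc in \<open>auto simp: r_distr m_lcomm\<close>)
  from faithful_element_of_ideal[OF R this]
  obtain s where s: "s \<in> carrier R" "t \<otimes> s = \<zero>"
    and sA: "\<And>u. \<lbrakk>u \<in> carrier R; t \<otimes> u = \<zero>; s \<otimes> u = \<zero>\<rbrakk> \<Longrightarrow> u = \<zero>"
    by blast
  have "v = \<zero>" if v: "v \<in> carrier R" and z: "(t \<oplus> s) \<otimes> v = \<zero>" for v
  proof -
    have "t \<otimes> (t \<otimes> v) = t \<otimes> ((t \<oplus> s) \<otimes> v) \<ominus> (t \<otimes> s) \<otimes> v"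
      using tc s(1) v by algebra
    also have "\<dots> = \<zero>" using z s tc v by (simp add: minus_eq)
    finally have tv: "t \<otimes> v = \<zero>" by (rule reduced_ring_square_mult[OF R(3,1) tc v])
    with z have "s \<otimes> v = \<zero>" using tc s(1) v by (simp add: l_distr)
    with tv show ?thesis using sA v by blast
  qed
  then have "t \<oplus> s \<in> nonzerodivisors R"
    using tc s(1) unfolding nonzerodivisors_def by blast
  then have w: "t \<oplus> s \<in> Units R" using units by blast
  let ?i = "inv (t \<oplus> s)"
  have i: "?i \<in> carrier R" using w by simp
  have "x \<otimes> (t \<otimes> ?i) = x" if x: "x \<in> J" for x
  proof -
    have xc: "x \<in> carrier R" using x J.Icarr by blast
    have "t \<otimes> (x \<otimes> s) = x \<otimes> (t \<otimes> s)" using xc s(1) tc by (simp add: m_ac)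
    then have "t \<otimes> (x \<otimes> s) = \<zero>" using s(2) xc by simp
    then have xs: "x \<otimes> s = \<zero>" using t(2) J.I_r_closed[OF x s(1)] by blast
    have "x = x \<otimes> ((t \<oplus> s) \<otimes> ?i)" using w xc by simp
    also have "\<dots> = x \<otimes> (t \<oplus> s) \<otimes> ?i"
      by (rule m_assoc[symmetric]) (use xc tc s(1) i in auto)
    also have "x \<otimes> (t \<oplus> s) = x \<otimes> t"
      using xs xc tc s(1) by (simp add: r_distr)
    also have "x \<otimes> t \<otimes> ?i = x \<otimes> (t \<otimes> ?i)" by (rule m_assoc[OF xc tc i])
    finally show ?thesis by simp
  qed
  moreover have "t \<otimes> ?i \<in> J" using J.I_r_closed[OF t(1) i] .
  ultimately show ?thesis by blast
qed

lemma (in module) submodule_of_closed: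
  assumes "N \<subseteq> carrier M" "\<zero>\<^bsub>M\<^esub> \<in> N" "\<And>x y. \<lbrakk>x \<in> N; y \<in> N\<rbrakk> \<Longrightarrow> x \<oplus>\<^bsub>M\<^esub> y \<in> N"
    and mult: "\<And>r x. \<lbrakk>r \<in> carrier R; x \<in> N\<rbrakk> \<Longrightarrow> r \<odot>\<^bsub>M\<^esub> x \<in> N"
  shows "submodule N R M"
proof (rule submoduleI)
  show "\<ominus>\<^bsub>M\<^esub> a \<in> N" if "a \<in> N" for a
  proof -
    have "a \<in> carrier M" using that assms(1) by blast
    then have "(\<ominus> \<one>) \<odot>\<^bsub>M\<^esub> a = \<ominus>\<^bsub>M\<^esub> a" by (simp add: smult_l_minus)
    then show ?thesis using mult[OF _ that, of "\<ominus> \<one>"] by simp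
  qed
qed (use assms in auto)

text \<open>Over a ring in which every ideal has an identity element, submodules have complements. A complement
  of \<open>R v\<close> is a submodule \<open>N\<close> maximal with \<open>N \<inter> R v = 0\<close>, and the retraction sends \<open>x\<close> to the
  unique \<open>r\<close> with \<open>x - r v \<in> N\<close>. For its existence, take the identity \<open>\<epsilon>\<close> of the ideal of all \<open>r\<close> with
  \<open>r x \<in> N + R v\<close>: then \<open>y = (1 - \<epsilon>) x\<close> can be adjoined to \<open>N\<close>, so that \<open>y \<in> N\<close>, and
  \<open>x = y + \<epsilon> x \<in> N + R v\<close>.\<close>

lemma retraction_onto_free_submodule:
  fixes R (structure) and M :: "('a, 'm) module"
  assumes "module R M"
    and identities: "\<And>J. ideal J R \<Longrightarrow> \<exists>\<epsilon>\<in>J. \<forall>x\<in>J. x \<otimes> \<epsilon> = x"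
    and v: "v \<in> carrier M" and free: "\<And>r. \<lbrakk>r \<in> carrier R; r \<odot>\<^bsub>M\<^esub> v = \<zero>\<^bsub>M\<^esub>\<rbrakk> \<Longrightarrow> r = \<zero>"
  shows "\<exists>\<phi>\<in>linear_maps R M (regular_module R). \<phi> v = \<one>"
proof -
  interpret module R M by fact
  let ?F = "{N. submodule N R M \<and> (\<forall>r\<in>carrier R. r \<odot>\<^bsub>M\<^esub> v \<in> N \<longrightarrow> r = \<zero>)}"
  have "\<exists>N\<in>?F. \<forall>N'\<in>?F. N \<subseteq> N' \<longrightarrow> N' = N"
  proof (rule subset_Zorn_nonempty)
    have "submodule {\<zero>\<^bsub>M\<^esub>} R M" by (rule submodule_of_closed) auto
    then have "{\<zero>\<^bsub>M\<^esub>} \<in> ?F" using free by auto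
    then show "?F \<noteq> {}" by (rule ex_in_conv[THEN iffD1, OF exI])
    fix C assume ne: "C \<noteq> {}" and chain: "subset.chain ?F C"
    have CF: "C \<subseteq> ?F" using chain unfolding subset.chain_def by (rule conjunct1)
    have sub: "submodule N R M" if "N \<in> C" for N using subsetD[OF CF that] by simp
    have "submodule (\<Union>C) R M"
    proof (rule submodule_of_closed)
      show "\<Union>C \<subseteq> carrier M" using submoduleE(1)[OF sub] by (rule Union_least)
      obtain N where "N \<in> C" using ne by blast
      then show "\<zero>\<^bsub>M\<^esub> \<in> \<Union>C" using submoduleE(2,1)[OF sub] subgroup.one_closed[of N "add_monoid M"] sub
        by (force simp: submodule_def)
      show "x \<oplus>\<^bsub>M\<^esub> y \<in> \<Union>C" if xy: "x \<in> \<Union>C" "y \<in> \<Union>C" for x y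
      proof -
        obtain A B where AB: "A \<in> C" "B \<in> C" "x \<in> A" "y \<in> B" using xy by auto
        then have "A \<subseteq> B \<or> B \<subseteq> A" using chain unfolding subset.chain_def by blast
        then obtain D where "D \<in> C" "x \<in> D" "y \<in> D" using AB by blast
        then show ?thesis using submoduleE(5)[OF sub] by (intro UnionI[of D])
      qed
      show "r \<odot>\<^bsub>M\<^esub> x \<in> \<Union>C" if r: "r \<in> carrier R" and x: "x \<in> \<Union>C" for r x
      proof -
        obtain A where A: "A \<in> C" "x \<in> A" using x by (rule UnionE)
        then show ?thesis using submoduleE(4)[OF sub[OF A(1)] r] by (intro UnionI[of A])
      qed
    qed
    moreover have "r = \<zero>" if r: "r \<in> carrier R" "r \<odot>\<^bsub>M\<^esub> v \<in> \<Union>C" for r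
    proof -
      obtain A where A: "A \<in> C" "r \<odot>\<^bsub>M\<^esub> v \<in> A" using r(2) by (rule UnionE)
      then show ?thesis using subsetD[OF CF A(1)] r(1) by simp
    qed
    ultimately show "\<Union>C \<in> ?F" by simp
  qed
  then obtain N where "N \<in> ?F" and max: "\<forall>N'\<in>?F. N \<subseteq> N' \<longrightarrow> N' = N" by (rule bexE)
  then have N: "submodule N R M" and N_free: "\<And>r. \<lbrakk>r \<in> carrier R; r \<odot>\<^bsub>M\<^esub> v \<in> N\<rbrakk> \<Longrightarrow> r = \<zero>" by auto
  note NE = submoduleE[OF N]
  have Nc: "n \<in> carrier M" if "n \<in> N" for n using NE(1) that by (rule subsetD)
  have N0: "\<zero>\<^bsub>M\<^esub> \<in> N" using N subgroup.one_closed[of N "add_monoid M"] by (simp add: submodule_def)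
  have N_minus: "x \<ominus>\<^bsub>M\<^esub> y \<in> N" if "x \<in> N" "y \<in> N" for x y
    using NE(3)[OF that(2)] NE(5)[OF that(1)] by (simp add: M.minus_eq)
  have rep: "\<exists>r\<in>carrier R. x \<ominus>\<^bsub>M\<^esub> r \<odot>\<^bsub>M\<^esub> v \<in> N" if x: "x \<in> carrier M" for x
  proof -
    let ?J = "{r \<in> carrier R. \<exists>s\<in>carrier R. r \<odot>\<^bsub>M\<^esub> x \<ominus>\<^bsub>M\<^esub> s \<odot>\<^bsub>M\<^esub> v \<in> N}"
    have "ideal ?J R"
    proof (rule ideal_of_closed)
      have "\<zero> \<odot>\<^bsub>M\<^esub> x \<ominus>\<^bsub>M\<^esub> \<zero> \<odot>\<^bsub>M\<^esub> v \<in> N" using x v N_minus[OF N0 N0] by simp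
      then show "\<zero> \<in> ?J" by auto
      fix a assume "a \<in> ?J"
      then obtain s where a: "a \<in> carrier R" and s: "s \<in> carrier R" "a \<odot>\<^bsub>M\<^esub> x \<ominus>\<^bsub>M\<^esub> s \<odot>\<^bsub>M\<^esub> v \<in> N"
        by auto
      show "a \<oplus> b \<in> ?J" if bJ: "b \<in> ?J" for b
      proof -
        obtain t where b: "b \<in> carrier R" and t: "t \<in> carrier R" "b \<odot>\<^bsub>M\<^esub> x \<ominus>\<^bsub>M\<^esub> t \<odot>\<^bsub>M\<^esub> v \<in> N"
          using bJ by auto
        have "(a \<oplus> b) \<odot>\<^bsub>M\<^esub> x \<ominus>\<^bsub>M\<^esub> (s \<oplus> t) \<odot>\<^bsub>M\<^esub> v
            = (a \<odot>\<^bsub>M\<^esub> x \<ominus>\<^bsub>M\<^esub> s \<odot>\<^bsub>M\<^esub> v) \<oplus>\<^bsub>M\<^esub> (b \<odot>\<^bsub>M\<^esub> x \<ominus>\<^bsub>M\<^esub> t \<odot>\<^bsub>M\<^esub> v)"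
          using a b s(1) t(1) x v by (simp add: smult_l_distr M.minus_eq M.minus_add M.a_ac)
        then have "(a \<oplus> b) \<odot>\<^bsub>M\<^esub> x \<ominus>\<^bsub>M\<^esub> (s \<oplus> t) \<odot>\<^bsub>M\<^esub> v \<in> N" using NE(5)[OF s(2) t(2)] by simp
        then show ?thesis using a b s(1) t(1) by blast
      qed
      show "r \<otimes> a \<in> ?J" if r: "r \<in> carrier R" for r
      proof -
        have "(r \<otimes> a) \<odot>\<^bsub>M\<^esub> x \<ominus>\<^bsub>M\<^esub> (r \<otimes> s) \<odot>\<^bsub>M\<^esub> v = r \<odot>\<^bsub>M\<^esub> (a \<odot>\<^bsub>M\<^esub> x \<ominus>\<^bsub>M\<^esub> s \<odot>\<^bsub>M\<^esub> v)"
          using a s(1) r x v by (simp add: smult_assoc1 M.minus_eq smult_r_distr smult_r_minus)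
        then have "(r \<otimes> a) \<odot>\<^bsub>M\<^esub> x \<ominus>\<^bsub>M\<^esub> (r \<otimes> s) \<odot>\<^bsub>M\<^esub> v \<in> N" using NE(4)[OF r s(2)] by simp
        then show ?thesis using a s(1) r by blast
      qed
    qed auto
    from identities[OF this] obtain \<epsilon> where \<epsilon>J: "\<epsilon> \<in> ?J" and id: "\<forall>r\<in>?J. r \<otimes> \<epsilon> = r" by (rule bexE)
    from \<epsilon>J obtain s where \<epsilon>: "\<epsilon> \<in> carrier R"
      and s: "s \<in> carrier R" "\<epsilon> \<odot>\<^bsub>M\<^esub> x \<ominus>\<^bsub>M\<^esub> s \<odot>\<^bsub>M\<^esub> v \<in> N" by auto
    have idem: "\<epsilon> \<otimes> \<epsilon> = \<epsilon>" using bspec[OF id \<epsilon>J] .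
    define y where "y = (\<one> \<ominus> \<epsilon>) \<odot>\<^bsub>M\<^esub> x"
    have y: "y \<in> carrier M" using x \<epsilon> by (simp add: y_def)
    have y_eq: "y = x \<ominus>\<^bsub>M\<^esub> \<epsilon> \<odot>\<^bsub>M\<^esub> x"
      using x \<epsilon> by (simp add: y_def R.minus_eq M.minus_eq smult_l_distr smult_l_minus)
    let ?N' = "{n \<oplus>\<^bsub>M\<^esub> a \<odot>\<^bsub>M\<^esub> y | n a. n \<in> N \<and> a \<in> carrier R}"
    have "submodule ?N' R M"
    proof (rule submodule_of_closed)
      show "?N' \<subseteq> carrier M" using Nc y by auto
      have "\<zero>\<^bsub>M\<^esub> = \<zero>\<^bsub>M\<^esub> \<oplus>\<^bsub>M\<^esub> \<zero> \<odot>\<^bsub>M\<^esub> y" using y by simp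
      then show "\<zero>\<^bsub>M\<^esub> \<in> ?N'" using N0 R.zero_closed by blast
      fix m assume "m \<in> ?N'"
      then obtain n a where m: "m = n \<oplus>\<^bsub>M\<^esub> a \<odot>\<^bsub>M\<^esub> y" "n \<in> N" "a \<in> carrier R" by auto
      show "m \<oplus>\<^bsub>M\<^esub> m' \<in> ?N'" if m'N: "m' \<in> ?N'" for m'
      proof -
        obtain n' a' where m': "m' = n' \<oplus>\<^bsub>M\<^esub> a' \<odot>\<^bsub>M\<^esub> y" "n' \<in> N" "a' \<in> carrier R" using m'N by auto
        have "m \<oplus>\<^bsub>M\<^esub> m' = (n \<oplus>\<^bsub>M\<^esub> n') \<oplus>\<^bsub>M\<^esub> (a \<oplus> a') \<odot>\<^bsub>M\<^esub> y"
          using m m' Nc y by (simp add: smult_l_distr M.a_ac)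
        moreover have "n \<oplus>\<^bsub>M\<^esub> n' \<in> N" by (rule NE(5)[OF m(2) m'(2)])
        ultimately show ?thesis using m(3) m'(3) by blast
      qed
      show "r \<odot>\<^bsub>M\<^esub> m \<in> ?N'" if r: "r \<in> carrier R" for r
      proof -
        have "r \<odot>\<^bsub>M\<^esub> m = r \<odot>\<^bsub>M\<^esub> n \<oplus>\<^bsub>M\<^esub> (r \<otimes> a) \<odot>\<^bsub>M\<^esub> y"
          using m Nc y r by (simp add: smult_r_distr smult_assoc1)
        moreover have "r \<odot>\<^bsub>M\<^esub> n \<in> N" by (rule NE(4)[OF r m(2)])
        ultimately show ?thesis using m(3) r by blast
      qed
    qed
    moreover have "r = \<zero>" if r: "r \<in> carrier R" "r \<odot>\<^bsub>M\<^esub> v \<in> ?N'" for r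
    proof -
      obtain n a where na: "r \<odot>\<^bsub>M\<^esub> v = n \<oplus>\<^bsub>M\<^esub> a \<odot>\<^bsub>M\<^esub> y" "n \<in> N" "a \<in> carrier R" using r(2) by auto
      let ?b = "a \<otimes> (\<one> \<ominus> \<epsilon>)"
      have b: "?b \<in> carrier R" using na(3) \<epsilon> by simp
      have by': "?b \<odot>\<^bsub>M\<^esub> x = a \<odot>\<^bsub>M\<^esub> y" using na(3) \<epsilon> x by (simp add: y_def smult_assoc1)
      have "?b \<odot>\<^bsub>M\<^esub> x \<ominus>\<^bsub>M\<^esub> r \<odot>\<^bsub>M\<^esub> v = \<ominus>\<^bsub>M\<^esub> n"
        unfolding by' na(1) using na(2,3) y Nc[OF na(2)]
        by (simp add: M.minus_eq M.minus_add M.a_ac M.r_neg1 M.r_neg2 M.r_neg)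
      then have "?b \<odot>\<^bsub>M\<^esub> x \<ominus>\<^bsub>M\<^esub> r \<odot>\<^bsub>M\<^esub> v \<in> N" using NE(3)[OF na(2)] by simp
      then have "?b \<in> ?J" using b r(1) by blast
      then have "?b = ?b \<otimes> \<epsilon>" using id by simp
      also have "\<dots> = a \<otimes> (\<epsilon> \<ominus> \<epsilon> \<otimes> \<epsilon>)" using na(3) \<epsilon> by algebra
      also have "\<dots> = \<zero>" using na(3) \<epsilon> by (simp add: idem R.minus_eq R.r_neg)
      finally have "a \<odot>\<^bsub>M\<^esub> y = \<zero>\<^bsub>M\<^esub>" using by' x by simp
      then have "r \<odot>\<^bsub>M\<^esub> v \<in> N" using na(1,2) Nc[OF na(2)] by simp
      then show ?thesis by (rule N_free[OF r(1)])
    qed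
    ultimately have N'F: "?N' \<in> ?F" by simp
    have nN': "n \<in> ?N'" if "n \<in> N" for n
    proof -
      have "n = n \<oplus>\<^bsub>M\<^esub> \<zero> \<odot>\<^bsub>M\<^esub> y" using Nc[OF that] y by simp
      then show ?thesis using that R.zero_closed by blast
    qed
    then have "?N' = N" using max[rule_format, OF N'F] by (simp add: subset_iff)
    moreover have "y \<in> ?N'"
    proof -
      have "y = \<zero>\<^bsub>M\<^esub> \<oplus>\<^bsub>M\<^esub> \<one> \<odot>\<^bsub>M\<^esub> y" using y by simp
      then show ?thesis using N0 R.one_closed by blast
    qed
    ultimately have "y \<in> N" by simp
    have "x \<ominus>\<^bsub>M\<^esub> s \<odot>\<^bsub>M\<^esub> v = y \<oplus>\<^bsub>M\<^esub> (\<epsilon> \<odot>\<^bsub>M\<^esub> x \<ominus>\<^bsub>M\<^esub> s \<odot>\<^bsub>M\<^esub> v)"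
      unfolding y_eq using x \<epsilon> v s(1) by (simp add: M.minus_eq M.a_ac M.r_neg1 M.r_neg2 M.r_neg)
    then have "x \<ominus>\<^bsub>M\<^esub> s \<odot>\<^bsub>M\<^esub> v \<in> N" using NE(5)[OF \<open>y \<in> N\<close> s(2)] by simp
    then show ?thesis using s(1) by blast
  qed
  have uniq: "r = s" if rs: "r \<in> carrier R" "s \<in> carrier R"
    and "x \<in> carrier M" "x \<ominus>\<^bsub>M\<^esub> r \<odot>\<^bsub>M\<^esub> v \<in> N" "x \<ominus>\<^bsub>M\<^esub> s \<odot>\<^bsub>M\<^esub> v \<in> N" for r s x
  proof -
    have "(r \<ominus> s) \<odot>\<^bsub>M\<^esub> v = (x \<ominus>\<^bsub>M\<^esub> s \<odot>\<^bsub>M\<^esub> v) \<ominus>\<^bsub>M\<^esub> (x \<ominus>\<^bsub>M\<^esub> r \<odot>\<^bsub>M\<^esub> v)"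
      using rs that(3) v
      by (simp add: R.minus_eq M.minus_eq M.minus_add smult_l_distr smult_l_minus M.a_ac M.r_neg1 M.r_neg2 M.r_neg)
    then have "r \<ominus> s = \<zero>" using N_minus[OF that(5,4)] rs by (intro N_free) auto
    then show ?thesis using rs by simp
  qed
  have "\<forall>x\<in>carrier M. \<exists>r. r \<in> carrier R \<and> x \<ominus>\<^bsub>M\<^esub> r \<odot>\<^bsub>M\<^esub> v \<in> N" using rep by blast
  from bchoice[OF this] obtain \<phi>
    where \<phi>: "\<And>x. x \<in> carrier M \<Longrightarrow> \<phi> x \<in> carrier R" "\<And>x. x \<in> carrier M \<Longrightarrow> x \<ominus>\<^bsub>M\<^esub> \<phi> x \<odot>\<^bsub>M\<^esub> v \<in> N"
    by blast
  have "\<phi> (x \<oplus>\<^bsub>M\<^esub> y) = \<phi> x \<oplus> \<phi> y" if xy: "x \<in> carrier M" "y \<in> carrier M" for x y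
  proof (rule uniq)
    show "(x \<oplus>\<^bsub>M\<^esub> y) \<ominus>\<^bsub>M\<^esub> (\<phi> x \<oplus> \<phi> y) \<odot>\<^bsub>M\<^esub> v \<in> N"
    proof -
      have "(x \<oplus>\<^bsub>M\<^esub> y) \<ominus>\<^bsub>M\<^esub> (\<phi> x \<oplus> \<phi> y) \<odot>\<^bsub>M\<^esub> v
          = (x \<ominus>\<^bsub>M\<^esub> \<phi> x \<odot>\<^bsub>M\<^esub> v) \<oplus>\<^bsub>M\<^esub> (y \<ominus>\<^bsub>M\<^esub> \<phi> y \<odot>\<^bsub>M\<^esub> v)"
        using xy v \<phi>(1) by (simp add: smult_l_distr M.minus_eq M.minus_add M.a_ac)
      then show ?thesis using NE(5)[OF \<phi>(2)[OF xy(1)] \<phi>(2)[OF xy(2)]] by simp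
    qed
    show "(x \<oplus>\<^bsub>M\<^esub> y) \<ominus>\<^bsub>M\<^esub> \<phi> (x \<oplus>\<^bsub>M\<^esub> y) \<odot>\<^bsub>M\<^esub> v \<in> N" using \<phi>(2) xy by simp
  qed (use xy \<phi>(1) in auto)
  moreover have "\<phi> (r \<odot>\<^bsub>M\<^esub> x) = r \<otimes> \<phi> x" if r: "r \<in> carrier R" and x: "x \<in> carrier M" for r x
  proof (rule uniq)
    show "(r \<odot>\<^bsub>M\<^esub> x) \<ominus>\<^bsub>M\<^esub> (r \<otimes> \<phi> x) \<odot>\<^bsub>M\<^esub> v \<in> N"
    proof -
      have "(r \<odot>\<^bsub>M\<^esub> x) \<ominus>\<^bsub>M\<^esub> (r \<otimes> \<phi> x) \<odot>\<^bsub>M\<^esub> v = r \<odot>\<^bsub>M\<^esub> (x \<ominus>\<^bsub>M\<^esub> \<phi> x \<odot>\<^bsub>M\<^esub> v)"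
        using r x v \<phi>(1) by (simp add: smult_assoc1 M.minus_eq smult_r_distr smult_r_minus)
      then show ?thesis using NE(4)[OF r \<phi>(2)[OF x]] by simp
    qed
    show "(r \<odot>\<^bsub>M\<^esub> x) \<ominus>\<^bsub>M\<^esub> \<phi> (r \<odot>\<^bsub>M\<^esub> x) \<odot>\<^bsub>M\<^esub> v \<in> N" using \<phi>(2) r x by simp
  qed (use r x \<phi>(1) in auto)
  moreover have "\<phi> v = \<one>"
    by (rule uniq[OF _ _ v \<phi>(2)[OF v]]) (use v N0 \<phi>(1) in \<open>simp_all add: M.minus_eq M.r_neg\<close>)
  ultimately show ?thesis
    using \<phi>(1) unfolding linear_maps_def by (intro bexI[of _ \<phi>]) auto
qed

section \<open>Maps inverse to the Frobenius\<close>

context fraction_ring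
begin

abbreviation "RN \<equiv> carrier (normalization R K \<iota>)"

text \<open>An \<open>R\<close>-linear map from \<open>\<^sup>e(R\<^sup>N)\<close> to \<open>R\<^sup>N\<close>, with \<open>R\<close> acting through \<open>\<iota>\<close>.\<close>

definition cartier_map :: "nat \<Rightarrow> nat \<Rightarrow> ('c \<Rightarrow> 'c) \<Rightarrow> bool" where
  "cartier_map p e h \<longleftrightarrow> h \<in> RN \<rightarrow> RN \<and>
     (\<forall>x\<in>RN. \<forall>y\<in>RN. h (x \<oplus>\<^bsub>K\<^esub> y) = h x \<oplus>\<^bsub>K\<^esub> h y) \<and>
     (\<forall>r\<in>carrier R. \<forall>x\<in>RN. h (\<iota> (r [^]\<^bsub>R\<^esub> (p ^ e)) \<otimes>\<^bsub>K\<^esub> x) = \<iota> r \<otimes>\<^bsub>K\<^esub> h x)"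

lemma RN_carrier: "x \<in> RN \<Longrightarrow> x \<in> carrier K"
  by (simp add: carrier_normalization)

lemma \<iota>_RN: "r \<in> carrier R \<Longrightarrow> \<iota> r \<in> RN"
  by (simp add: carrier_normalization integral_\<iota>)

lemma one_RN: "\<one>\<^bsub>K\<^esub> \<in> RN"
  using \<iota>_RN[OF R.one_closed] by simp

lemma scale_RN: "\<lbrakk>r \<in> carrier R; x \<in> RN\<rbrakk> \<Longrightarrow> \<iota> r \<otimes>\<^bsub>K\<^esub> x \<in> RN"
  by (simp add: carrier_normalization integral_scale)

lemma cartier_map_comp:
  assumes g: "cartier_map p a g" and h: "cartier_map p b h"
  shows "cartier_map p (a + b) (g \<circ> h)"
proof -
  have gD: "\<And>x. x \<in> RN \<Longrightarrow> g x \<in> RN"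
      "\<And>x y. \<lbrakk>x \<in> RN; y \<in> RN\<rbrakk> \<Longrightarrow> g (x \<oplus>\<^bsub>K\<^esub> y) = g x \<oplus>\<^bsub>K\<^esub> g y"
      "\<And>r x. \<lbrakk>r \<in> carrier R; x \<in> RN\<rbrakk> \<Longrightarrow> g (\<iota> (r [^]\<^bsub>R\<^esub> (p ^ a)) \<otimes>\<^bsub>K\<^esub> x) = \<iota> r \<otimes>\<^bsub>K\<^esub> g x"
    using g unfolding cartier_map_def by auto
  have hD: "\<And>x. x \<in> RN \<Longrightarrow> h x \<in> RN"
      "\<And>x y. \<lbrakk>x \<in> RN; y \<in> RN\<rbrakk> \<Longrightarrow> h (x \<oplus>\<^bsub>K\<^esub> y) = h x \<oplus>\<^bsub>K\<^esub> h y"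
      "\<And>r x. \<lbrakk>r \<in> carrier R; x \<in> RN\<rbrakk> \<Longrightarrow> h (\<iota> (r [^]\<^bsub>R\<^esub> (p ^ b)) \<otimes>\<^bsub>K\<^esub> x) = \<iota> r \<otimes>\<^bsub>K\<^esub> h x"
    using h unfolding cartier_map_def by auto
  have "(g \<circ> h) (\<iota> (r [^]\<^bsub>R\<^esub> (p ^ (a + b))) \<otimes>\<^bsub>K\<^esub> x) = \<iota> r \<otimes>\<^bsub>K\<^esub> (g \<circ> h) x"
    if r: "r \<in> carrier R" and x: "x \<in> RN" for r x
  proof -
    have "r [^]\<^bsub>R\<^esub> (p ^ (a + b)) = (r [^]\<^bsub>R\<^esub> (p ^ a)) [^]\<^bsub>R\<^esub> (p ^ b)"
      using r by (simp add: R.nat_pow_pow power_add)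
    then show ?thesis
      using hD(3)[OF _ x, of "r [^]\<^bsub>R\<^esub> (p ^ a)"] gD(3)[OF r hD(1)[OF x]] r by simp
  qed
  then show ?thesis unfolding cartier_map_def using gD(1,2) hD(1,2) by simp
qed

text \<open>A splitting \<open>g\<close> of a positive power of the Frobenius raises the exponent of \<open>h\<close> arbitrarily, while
  \<open>u\<close> is still sent to \<open>1\<close>.\<close>

lemma cartier_map_funpow:
  assumes g: "cartier_map p a g" "g \<one>\<^bsub>K\<^esub> = \<one>\<^bsub>K\<^esub>" and h: "cartier_map p b h" "h u = \<one>\<^bsub>K\<^esub>"
  shows "cartier_map p (k * a + b) ((g ^^ k) \<circ> h) \<and> ((g ^^ k) \<circ> h) u = \<one>\<^bsub>K\<^esub>"
proof (induction k)
  case 0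
  then show ?case using h by (simp add: o_def)
next
  case (Suc k)
  then have "cartier_map p (a + (k * a + b)) (g \<circ> ((g ^^ k) \<circ> h))"
    by (intro cartier_map_comp[OF g(1)]) (rule conjunct1)
  with Suc g(2) show ?case by (simp add: o_def add.assoc)
qed

lemma cartier_map_premult:
  assumes h: "cartier_map p e h" and s: "s \<in> carrier R"
  shows "cartier_map p e (\<lambda>x. h (\<iota> s \<otimes>\<^bsub>K\<^esub> x))"
proof -
  have hD: "\<And>x. x \<in> RN \<Longrightarrow> h x \<in> RN"
      "\<And>x y. \<lbrakk>x \<in> RN; y \<in> RN\<rbrakk> \<Longrightarrow> h (x \<oplus>\<^bsub>K\<^esub> y) = h x \<oplus>\<^bsub>K\<^esub> h y"
      "\<And>r x. \<lbrakk>r \<in> carrier R; x \<in> RN\<rbrakk> \<Longrightarrow> h (\<iota> (r [^]\<^bsub>R\<^esub> (p ^ e)) \<otimes>\<^bsub>K\<^esub> x) = \<iota> r \<otimes>\<^bsub>K\<^esub> h x"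
    using h unfolding cartier_map_def by auto
  have "h (\<iota> s \<otimes>\<^bsub>K\<^esub> (x \<oplus>\<^bsub>K\<^esub> y)) = h (\<iota> s \<otimes>\<^bsub>K\<^esub> x) \<oplus>\<^bsub>K\<^esub> h (\<iota> s \<otimes>\<^bsub>K\<^esub> y)"
    if "x \<in> RN" "y \<in> RN" for x y
    using hD(2)[OF scale_RN[OF s that(1)] scale_RN[OF s that(2)]] that RN_carrier s
    by (simp add: S.r_distr)
  moreover have "h (\<iota> s \<otimes>\<^bsub>K\<^esub> (\<iota> (r [^]\<^bsub>R\<^esub> (p ^ e)) \<otimes>\<^bsub>K\<^esub> x)) = \<iota> r \<otimes>\<^bsub>K\<^esub> h (\<iota> s \<otimes>\<^bsub>K\<^esub> x)"
    if "r \<in> carrier R" "x \<in> RN" for r x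
    using hD(3)[OF that(1) scale_RN[OF s that(2)]] that RN_carrier[OF that(2)] s
      S.m_lcomm[of "\<iota> s" "\<iota> (r [^]\<^bsub>R\<^esub> (p ^ e))" x] by simp
  ultimately show ?thesis unfolding cartier_map_def using hD(1) scale_RN[OF s] by simp
qed

lemma strongly_F_regular_cartier_map:
  assumes SFR: "strongly_F_regular p (normalization R K \<iota>)" and s: "s \<in> nonzerodivisors R"
  shows "\<exists>e h. cartier_map p e h \<and> h (\<iota> s) = \<one>\<^bsub>K\<^esub>"
proof -
  let ?S = "normalization R K \<iota>"
  have sc: "s \<in> carrier R" using s unfolding nonzerodivisors_def by simp
  have u: "\<iota> s \<in> Units K" by (rule \<iota>_unit[OF s])
  have ops: "monoid.mult ?S = monoid.mult K" "add ?S = add K" "\<zero>\<^bsub>?S\<^esub> = \<zero>\<^bsub>K\<^esub>" "\<one>\<^bsub>?S\<^esub> = \<one>\<^bsub>K\<^esub>"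
    "\<And>x n. x [^]\<^bsub>?S\<^esub> (n::nat) = x [^]\<^bsub>K\<^esub> n"
    by (simp_all add: normalization_def nat_pow_def)
  have "x = \<zero>\<^bsub>K\<^esub>" if "x \<in> RN" "\<iota> s \<otimes>\<^bsub>K\<^esub> x = \<zero>\<^bsub>K\<^esub>" for x
  proof -
    have "\<iota> s \<otimes>\<^bsub>K\<^esub> x = \<iota> s \<otimes>\<^bsub>K\<^esub> \<zero>\<^bsub>K\<^esub>" using that(2) sc by simp
    then show ?thesis
      using S.Units_l_cancel[OF u RN_carrier[OF that(1)] S.zero_closed] by simp
  qed
  then have "\<iota> s \<in> nonzerodivisors ?S"
    unfolding nonzerodivisors_def ops using \<iota>_RN[OF sc] by blast
  then have "\<iota> s \<in> off_minimal_primes ?S" by (rule subsetD[OF nonzerodivisor_off_minimal_primes])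
  then obtain e h where h: "h \<in> linear_maps ?S (frobenius_module p e ?S) (regular_module ?S)"
    and one: "h (\<iota> s) = \<one>\<^bsub>?S\<^esub>"
    using SFR unfolding strongly_F_regular_def by blast
  have "h (\<iota> (r [^]\<^bsub>R\<^esub> (p ^ e)) \<otimes>\<^bsub>K\<^esub> x) = \<iota> r \<otimes>\<^bsub>K\<^esub> h x" if "r \<in> carrier R" "x \<in> RN" for r x
    using h \<iota>_RN[OF that(1)] that unfolding linear_maps_def by (simp add: ops)
  then have "cartier_map p e h"
    using h unfolding linear_maps_def cartier_map_def by (simp add: ops)
  then show ?thesis using one ops(4) by auto
qed

text \<open>Multiplication by an element of the conductor maps \<open>R\<^sup>N\<close> into \<open>R\<close>, which turns maps on \<open>R\<^sup>N\<close> into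
  maps on \<open>R\<close>.\<close>

lemma cartier_map_restrict:
  assumes h: "cartier_map p e h" and r: "r \<in> conductor R K \<iota>"
    and c: "c \<in> carrier R" "h (\<iota> c) = \<one>\<^bsub>K\<^esub>"
  shows "\<exists>\<psi>\<in>linear_maps R (frobenius_module p e R) (regular_module R). \<psi> c = r"
proof -
  have rc: "r \<in> carrier R" and cond: "\<And>y. y \<in> RN \<Longrightarrow> \<iota> r \<otimes>\<^bsub>K\<^esub> y \<in> imR"
    using r unfolding conductor_def by auto
  have hD: "\<And>x. x \<in> RN \<Longrightarrow> h x \<in> RN"
      "\<And>x y. \<lbrakk>x \<in> RN; y \<in> RN\<rbrakk> \<Longrightarrow> h (x \<oplus>\<^bsub>K\<^esub> y) = h x \<oplus>\<^bsub>K\<^esub> h y"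
      "\<And>r x. \<lbrakk>r \<in> carrier R; x \<in> RN\<rbrakk> \<Longrightarrow> h (\<iota> (r [^]\<^bsub>R\<^esub> (p ^ e)) \<otimes>\<^bsub>K\<^esub> x) = \<iota> r \<otimes>\<^bsub>K\<^esub> h x"
    using h unfolding cartier_map_def by auto
  have "\<forall>x\<in>carrier R. \<exists>b. b \<in> carrier R \<and> \<iota> b = \<iota> r \<otimes>\<^bsub>K\<^esub> h (\<iota> x)"
  proof
    fix x assume "x \<in> carrier R"
    then have "\<iota> r \<otimes>\<^bsub>K\<^esub> h (\<iota> x) \<in> imR" by (intro cond hD(1) \<iota>_RN)
    then obtain b where "\<iota> r \<otimes>\<^bsub>K\<^esub> h (\<iota> x) = \<iota> b" "b \<in> carrier R" by (rule imageE)
    then show "\<exists>b. b \<in> carrier R \<and> \<iota> b = \<iota> r \<otimes>\<^bsub>K\<^esub> h (\<iota> x)" by (intro exI[of _ b]) simp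
  qed
  from bchoice[OF this] obtain \<psi> where \<psi>: "\<And>x. x \<in> carrier R \<Longrightarrow> \<psi> x \<in> carrier R"
    "\<And>x. x \<in> carrier R \<Longrightarrow> \<iota> (\<psi> x) = \<iota> r \<otimes>\<^bsub>K\<^esub> h (\<iota> x)" by auto
  have hK: "\<And>x. x \<in> carrier R \<Longrightarrow> h (\<iota> x) \<in> carrier K" by (intro RN_carrier hD(1) \<iota>_RN)
  have "\<psi> (x \<oplus>\<^bsub>R\<^esub> y) = \<psi> x \<oplus>\<^bsub>R\<^esub> \<psi> y" if "x \<in> carrier R" "y \<in> carrier R" for x y
  proof (rule \<iota>_inj)
    show "\<iota> (\<psi> (x \<oplus>\<^bsub>R\<^esub> y)) = \<iota> (\<psi> x \<oplus>\<^bsub>R\<^esub> \<psi> y)"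
      using that \<psi> hD(2) \<iota>_RN hK rc by (simp add: S.r_distr)
  qed (use that \<psi>(1) in auto)
  moreover have "\<psi> (t [^]\<^bsub>R\<^esub> (p ^ e) \<otimes>\<^bsub>R\<^esub> x) = t \<otimes>\<^bsub>R\<^esub> \<psi> x" if "t \<in> carrier R" "x \<in> carrier R" for t x
  proof (rule \<iota>_inj)
    show "\<iota> (\<psi> (t [^]\<^bsub>R\<^esub> (p ^ e) \<otimes>\<^bsub>R\<^esub> x)) = \<iota> (t \<otimes>\<^bsub>R\<^esub> \<psi> x)"
      using that \<psi> hD(3)[OF that(1) \<iota>_RN[OF that(2)]] hK[OF that(2)] rc
      by (simp add: S.m_lcomm)
  qed (use that \<psi>(1) in auto)
  moreover have "\<psi> c = r"
    by (rule \<iota>_inj) (use \<psi> c rc in auto)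
  ultimately show ?thesis
    using \<psi>(1) unfolding linear_maps_def by (intro bexI[of _ \<psi>]) auto
qed

text \<open>If \<open>w = 1/s\<close> is integral with \<open>s\<^sup>n w\<^sup>m \<in> R\<close> for all \<open>m\<close>, then \<open>w = s\<^sup>n w\<^sup>n\<^sup>+\<^sup>1\<close> is in \<open>R\<close>.\<close>

lemma unit_of_integral_inverse:
  assumes s: "s \<in> carrier R" and w: "w \<in> RN" "\<iota> s \<otimes>\<^bsub>K\<^esub> w = \<one>\<^bsub>K\<^esub>"
  shows "s \<in> Units R"
proof -
  have wK: "w \<in> carrier K" and int: "integral_over R K \<iota> w" using w(1) by (auto simp: carrier_normalization)
  have "\<iota> s \<otimes>\<^bsub>K\<^esub> w \<in> imR" using w(2) hom_one R.one_closed by (metis imageI)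
  then have "\<exists>n::nat. \<forall>m::nat. \<iota> (s [^]\<^bsub>R\<^esub> n) \<otimes>\<^bsub>K\<^esub> w [^]\<^bsub>K\<^esub> m \<in> imR"
    by (rule integral_bounded_denominator[OF int wK s])
  then obtain n :: nat where "\<And>m::nat. \<iota> (s [^]\<^bsub>R\<^esub> n) \<otimes>\<^bsub>K\<^esub> w [^]\<^bsub>K\<^esub> m \<in> imR" by blast
  then have "\<iota> (s [^]\<^bsub>R\<^esub> n) \<otimes>\<^bsub>K\<^esub> w [^]\<^bsub>K\<^esub> Suc n \<in> imR" .
  also have "\<iota> (s [^]\<^bsub>R\<^esub> n) \<otimes>\<^bsub>K\<^esub> w [^]\<^bsub>K\<^esub> Suc n = (\<iota> s \<otimes>\<^bsub>K\<^esub> w) [^]\<^bsub>K\<^esub> n \<otimes>\<^bsub>K\<^esub> w"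
    using s wK by (simp add: S.nat_pow_distrib S.m_assoc)
  also have "\<dots> = w" using wK by (simp add: w(2))
  finally obtain b where b: "w = \<iota> b" "b \<in> carrier R" by (rule imageE)
  have "\<iota> (s \<otimes>\<^bsub>R\<^esub> b) = \<iota> \<one>\<^bsub>R\<^esub>" using w(2) b s by simp
  then have "s \<otimes>\<^bsub>R\<^esub> b = \<one>\<^bsub>R\<^esub>" by (rule \<iota>_inj) (use s b in auto)
  then show ?thesis using s b(2) R.m_comm[of s b] unfolding Units_def by auto
qed

text \<open>Tight closure only controls large exponents, so the exponent supplied by strong \<open>F\<close>-regularity has
  to be increased. If some nonzerodivisor \<open>s\<close> of \<open>R\<close> is sent to \<open>1\<close> by a map of positive exponent,
  then premultiplying by \<open>s\<close> gives a splitting that can be iterated. Otherwise all exponents are \<open>0\<close>,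
  which says no more than that every nonzerodivisor of \<open>R\<close> is a unit of \<open>R\<^sup>N\<close>. Then these elements
  are units of \<open>R\<close>, so \<open>R\<close> is a product of fields, and over such a ring \<open>R \<cdot> \<^sup>ec\<close> is a
  direct summand of \<open>\<^sup>eR\<close> for every \<open>e\<close>.\<close>

lemma linear_map_to_conductor_element:
  assumes noeth: "noetherian_ring R" and red: "reduced_ring R"
    and p: "Factorial_Ring.prime p" and char: "has_characteristic R p"
    and SFR: "strongly_F_regular p (normalization R K \<iota>)"
    and c: "c \<in> nonzerodivisors R" and r: "r \<in> conductor R K \<iota>"
  shows "\<exists>e\<ge>e\<^sub>0. \<exists>\<psi>\<in>linear_maps R (frobenius_module p e R) (regular_module R). \<psi> c = r"
proof (cases "\<exists>s\<in>nonzerodivisors R. \<exists>e\<ge>1. \<exists>h. cartier_map p e h \<and> h (\<iota> s) = \<one>\<^bsub>K\<^esub>")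
  case True
  then obtain s a h where s: "s \<in> nonzerodivisors R" and a: "a \<ge> 1"
    and h: "cartier_map p a h" "h (\<iota> s) = \<one>\<^bsub>K\<^esub>" by blast
  have sc: "s \<in> carrier R" and cc: "c \<in> carrier R" using s c unfolding nonzerodivisors_def by auto
  obtain b f where f: "cartier_map p b f" "f (\<iota> c) = \<one>\<^bsub>K\<^esub>"
    using strongly_F_regular_cartier_map[OF SFR c] by blast
  let ?g = "\<lambda>x. h (\<iota> s \<otimes>\<^bsub>K\<^esub> x)"
  have "?g \<one>\<^bsub>K\<^esub> = \<one>\<^bsub>K\<^esub>" using h(2) sc by simp
  from cartier_map_funpow[OF cartier_map_premult[OF h(1) sc] this f, of e\<^sub>0]
  have F: "cartier_map p (e\<^sub>0 * a + b) ((?g ^^ e\<^sub>0) \<circ> f)" "((?g ^^ e\<^sub>0) \<circ> f) (\<iota> c) = \<one>\<^bsub>K\<^esub>"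
    by blast+
  have "e\<^sub>0 \<le> e\<^sub>0 * a + b" using a by (metis le_add1 mult.right_neutral mult_le_mono2 order_trans)
  with cartier_map_restrict[OF F(1) r cc F(2)] show ?thesis by blast
next
  case False
  have units: "nonzerodivisors R \<subseteq> Units R"
  proof
    fix s assume s: "s \<in> nonzerodivisors R"
    then have sc: "s \<in> carrier R" unfolding nonzerodivisors_def by simp
    obtain e h where h: "cartier_map p e h" "h (\<iota> s) = \<one>\<^bsub>K\<^esub>"
      using strongly_F_regular_cartier_map[OF SFR s] by blast
    from h(1) have lin: "\<forall>r\<in>carrier R. \<forall>x\<in>RN. h (\<iota> (r [^]\<^bsub>R\<^esub> (p ^ e)) \<otimes>\<^bsub>K\<^esub> x) = \<iota> r \<otimes>\<^bsub>K\<^esub> h x"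
      unfolding cartier_map_def by blast
    have "e = 0" using False s h by (metis One_nat_def Suc_leI neq0_conv)
    have "\<iota> s \<otimes>\<^bsub>K\<^esub> h \<one>\<^bsub>K\<^esub> = h (\<iota> (s [^]\<^bsub>R\<^esub> (p ^ e)) \<otimes>\<^bsub>K\<^esub> \<one>\<^bsub>K\<^esub>)"
      by (rule bspec[OF bspec[OF lin sc] one_RN, THEN sym])
    also have "\<dots> = \<one>\<^bsub>K\<^esub>" using h(2) sc \<open>e = 0\<close> by simp
    finally have "\<iota> s \<otimes>\<^bsub>K\<^esub> h \<one>\<^bsub>K\<^esub> = \<one>\<^bsub>K\<^esub>" .
    moreover have "h \<one>\<^bsub>K\<^esub> \<in> RN" using h(1) one_RN unfolding cartier_map_def by blast
    ultimately show "s \<in> Units R" using unit_of_integral_inverse[OF sc] by blast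
  qed
  have cc: "c \<in> carrier R" and creg: "\<And>x. \<lbrakk>x \<in> carrier R; c \<otimes>\<^bsub>R\<^esub> x = \<zero>\<^bsub>R\<^esub>\<rbrakk> \<Longrightarrow> x = \<zero>\<^bsub>R\<^esub>"
    using c unfolding nonzerodivisors_def by auto
  have rc: "r \<in> carrier R" using r unfolding conductor_def by simp
  have "\<exists>\<phi>\<in>linear_maps R (frobenius_module p e\<^sub>0 R) (regular_module R). \<phi> c = \<one>\<^bsub>R\<^esub>"
  proof (rule retraction_onto_free_submodule[OF R.module_frobenius_module[OF p char]])
    show "\<exists>\<epsilon>\<in>J. \<forall>x\<in>J. x \<otimes>\<^bsub>R\<^esub> \<epsilon> = x" if "ideal J R" for J
      by (rule ideal_has_identity[OF R.is_cring noeth red units that])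
    fix t assume t: "t \<in> carrier R"
      and "t \<odot>\<^bsub>frobenius_module p e\<^sub>0 R\<^esub> c = \<zero>\<^bsub>frobenius_module p e\<^sub>0 R\<^esub>"
    then have "c \<otimes>\<^bsub>R\<^esub> t [^]\<^bsub>R\<^esub> (p ^ e\<^sub>0) = \<zero>\<^bsub>R\<^esub>" using cc by (simp add: R.m_comm)
    then have "t [^]\<^bsub>R\<^esub> (p ^ e\<^sub>0) = \<zero>\<^bsub>R\<^esub>" using creg t by simp
    then show "t = \<zero>\<^bsub>R\<^esub>" using red t unfolding reduced_ring_def by blast
  qed (use cc in simp)
  then obtain \<phi> where \<phi>: "\<phi> \<in> linear_maps R (frobenius_module p e\<^sub>0 R) (regular_module R)" "\<phi> c = \<one>\<^bsub>R\<^esub>"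
    by (rule bexE)
  have "(\<lambda>x. r \<otimes>\<^bsub>R\<^esub> \<phi> x) \<in> linear_maps R (frobenius_module p e\<^sub>0 R) (regular_module R)"
    using \<phi>(1) rc unfolding linear_maps_def
    by (auto simp: Pi_iff R.r_distr R.m_lcomm)
  moreover have "r \<otimes>\<^bsub>R\<^esub> \<phi> c = r" using \<phi>(2) rc by simp
  ultimately show ?thesis by (intro exI[of _ e\<^sub>0] conjI order_refl) (rule bexI)
qed

text \<open>Tensoring a map \<open>\<^sup>eR \<rightarrow> R\<close>, \<open>\<^sup>ec \<mapsto> r\<close>, with \<open>M\<close> takes the vanishing tensor \<open>\<^sup>ec \<otimes> z\<close> to \<open>r z\<close>.\<close>

lemma conductor_subset_big_test_ideal:
  assumes noeth: "noetherian_ring R" and red: "reduced_ring R"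
    and p: "Factorial_Ring.prime p" and char: "has_characteristic R p"
    and SFR: "strongly_F_regular p (normalization R K \<iota>)"
  shows "conductor R K \<iota> \<subseteq> big_test_ideal p R TYPE('u)"
proof
  fix r assume r: "r \<in> conductor R K \<iota>"
  have "r \<odot>\<^bsub>M\<^esub> z = \<zero>\<^bsub>M\<^esub>" if M: "module R M" and z: "z \<in> zero_tight_closure p R M"
    for M :: "('a, 'u) module" and z
  proof -
    obtain c where zc: "z \<in> carrier M" and c: "c \<in> off_minimal_primes R"
      and ev: "\<forall>\<^sub>F e in sequentially. pure_tensor R (frobenius_module p e R) M c z =
        \<one>\<^bsub>tensor_product R (frobenius_module p e R) M\<^esub>"
      using z unfolding zero_tight_closure_def by blast
    obtain e\<^sub>0 where e\<^sub>0: "\<forall>e\<ge>e\<^sub>0. pure_tensor R (frobenius_module p e R) M c z =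
        \<one>\<^bsub>tensor_product R (frobenius_module p e R) M\<^esub>"
      using ev unfolding eventually_sequentially by (rule exE)
    have c': "c \<in> nonzerodivisors R" using c R.off_minimal_primes_reduced[OF red] by simp
    then have cc: "c \<in> carrier R" unfolding nonzerodivisors_def by simp
    obtain e \<psi> where e: "e \<ge> e\<^sub>0"
      and \<psi>: "\<psi> \<in> linear_maps R (frobenius_module p e R) (regular_module R)" "\<psi> c = r"
      using linear_map_to_conductor_element[OF noeth red p char SFR c' r, of e\<^sub>0] by blast
    have "\<psi> c \<odot>\<^bsub>M\<^esub> z = \<zero>\<^bsub>M\<^esub>"
      by (rule linear_map_tensor_vanishes[OF R.module_frobenius_module[OF p char] M \<psi>(1) _ zc e\<^sub>0[rule_format, OF e]])
        (simp add: cc)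
    then show ?thesis using \<psi>(2) by simp
  qed
  then show "r \<in> big_test_ideal p R TYPE('u)"
    using r unfolding big_test_ideal_def conductor_def by blast
qed

end

theorem theorem7p10:
  fixes R :: "('a, 'r) ring_scheme" and K :: "('k, 's) ring_scheme"
    and \<iota> :: "'a \<Rightarrow> 'k" and p :: nat
  assumes "cring R" and "noetherian_ring R"
    and "Factorial_Ring.prime p" and "has_characteristic R p"
    and "F_finite p R" and "reduced_ring R"
    and "total_ring_of_fractions R K \<iota>"
    and "strongly_F_regular p (normalization R K \<iota>)"
  shows "conductor R K \<iota> = finitistic_test_ideal p R \<and>
    finitistic_test_ideal p R = big_test_ideal p R TYPE(('a, 'm) module_universe)"
proof -
  interpret fraction_ring R K \<iota>
    using assms(1,7) by (simp add: fraction_ring_def fraction_ring_axioms_def)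
  let ?f = "\<lambda>C. Inl {g. g 0 \<in> C} :: ('a, 'm) module_universe"
  have "inj ?f"
  proof (rule injI)
    fix C D :: "'a set" assume "?f C = ?f D"
    then have eq: "{g. g (0::nat) \<in> C} = {g. g 0 \<in> D}" by simp
    have "x \<in> C \<longleftrightarrow> x \<in> D" for x
      using arg_cong[OF eq, of "\<lambda>A. (\<lambda>_. x) \<in> A"] by simp
    then show "C = D" by blast
  qed
  then have "big_test_ideal p R TYPE(('a, 'm) module_universe) \<subseteq> finitistic_test_ideal p R"
    by (rule R.big_test_ideal_subset_finitistic_test_ideal[OF assms(3,4)])
  moreover have "finitistic_test_ideal p R \<subseteq> conductor R K \<iota>"
    by (rule finitistic_test_ideal_subset_conductor)
  moreover have "conductor R K \<iota> \<subseteq> big_test_ideal p R TYPE(('a, 'm) module_universe)"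
    by (rule conductor_subset_big_test_ideal[OF assms(2,6,3,4,8)])
  ultimately show ?thesis by blast
qed

end
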